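(* Let $f=\bigoplus_{\ell\in A}a_\ell w^\ell\in\mathbb{TR}[w_1,\ldots,w_n]$ be a tropical polynomial with signs, where $A\subseteq\mathbb{N}^n$ is finite and $\langle A\rangle=\mathbb{Z}^n$. Let $p\in\mathbb{TR}^n$ be a point all of whose coordinates are positive (have sign $+1$), and let $\emptyset=\mathcal{F}_{-1}(p)\subsetneq\mathcal{F}_0(p)\subsetneq\cdots\subsetneq\mathcal{F}_r(p)$ be the flag of $f$ with respect to $p$. For each $i$ let $\mathcal{F}_i^+$ (resp. $\mathcal{F}_i^-$) be the set of $\ell\in\mathcal{F}_i(p)$ such that $a_\ell$ has sign $+1$ (resp. $-1$). Then $p$ is a singular point of $\mathcal{T}_{\mathbb{R}}(f)$ if and only if for all $i=0,\ldots,r$ and for every hyperplane $L\subset\mathbb{R}^n$ such that $\mathcal{F}_{i-1}(p)\subseteq L$ and $\mathcal{F}_i(p)\not\subseteq L$, $L$ does not separate $\mathcal{F}_i^+$ and $\mathcal{F}_i^-$.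
   Context: $\mathbb{K}=\bigcup_{m\ge1}\mathbb{R}((t^{1/m}))$ is the real closed field of real Puiseux series; the valuation $v(x)\in\mathbb{Q}$ of $x\in\mathbb{K}^*$ is the least exponent of $t$ occurring in $x$, and $x>0$ iff the coefficient of its least-exponent term is positive. Put $\mathbb{TR}=\{1,-1\}\times\mathbb{R}$ (with the product topology) and $trop:\mathbb{K}^*\to\mathbb{TR}$, $trop(x)=(s(x),v(x))$ with $s(x)=\pm1$ the sign of $x$; $trop$ is applied component-wise on $(\mathbb{K}^* )^n$. For $a=(\sigma,\alpha)\in\mathbb{TR}$ write $s(a)=\sigma$ (sign) and $|a|=\alpha$ (modulus); for $p\in\mathbb{TR}^n$, $|p|=(|p_1|,\ldots,|p_n|)$. A tropical polynomial with signs is a formal sum $f=\bigoplus_{\ell\in A}a_\ell w^\ell$ with $A$ finite and $a_\ell\in\mathbb{TR}$. $\mathcal{T}_{\mathbb{R}}(f)\subseteq\mathbb{TR}^n$ is the set of points $p$ for which there are two exponents $i\neq j$ in $A$, both attaining $\min_{\ell\in A}\big(|a_\ell|+\langle \ell,|p|\rangle\big)$, such that $s(a_i)\prod_{k=1}^n s(p_k)^{i_k}=1$ and $s(a_j)\prod_{k=1}^n s(p_k)^{j_k}=-1$. For $F=\sum_{\ell\in A}c_\ell x^\ell\in\mathbb{K}[x_1,\ldots,x_n]$ with all $c_\ell\neq0$, $trop(F)=\bigoplus_{\ell\in A}trop(c_\ell)w^\ell$. $\langle A\rangle=\mathbb{Z}^n$ means that the affine lattice generated by $A$ (integer combinations with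 coefficients summing to $1$) is $\mathbb{Z}^n$. In the flag, $\langle\mathcal{F}_\ell\rangle$ denotes the affine span in $\mathbb{R}^n$ (empty for the empty set). Flag of $f$ with respect to $p$: $\mathcal{F}_{-1}(p)=\emptyset$ and, inductively, $\mathcal{F}_{\ell+1}(p)\setminus\mathcal{F}_\ell(p)$ is the set of those $j\in A\setminus\langle\mathcal{F}_\ell(p)\rangle$ at which $|a_j|+\langle j,|p|\rangle$ attains its minimum over $A\setminus\langle\mathcal{F}_\ell(p)\rangle$; the process stops at the index $r$ for which $\dim\langle\mathcal{F}_r(p)\rangle=n$. Separation: for disjoint sets $B,C\subseteq\mathbb{R}^n$, a hyperplane (affine hyperplane of $\mathbb{R}^n$) $L$ separates $B$ and $C$ if $B\cup C\not\subseteq L$ and $B$, $C$ are contained in different closed halfspaces defined by $L$, i.e. $B\subseteq L_{\ge0}$ and $C\subseteq L_{\le0}$, or $B\subseteq L_{\le0}$ and $C\subseteq L_{\ge0}$. (If $B=\emptyset$, any $L$ with $C\not\subseteq L$ having $C$ in one closed halfspace separates.) Singular points: call a pair $(f,p)$, with $f$ of support $A$ and $p\in\mathbb{TR}^n$, liftable if there are $F\in\mathbb{K}[x_1,\ldots,x_n]$ and $P\in(\mathbb{K}^* )^n$ such that $trop(F)=f$, $trop(P)=p$ and $P$ is a singular point of $\{F=0\}$ (i.e. $F(P)=0$ and $\frac{\partial F}{\partial x_k}(P)=0$ for all $k$). The point $p$ is a singular point of $\mathcal{T}_{\mathbb{R}}(f)$ if $(f,p)$ lies in the closure, in $\mathbb{TR}^A\times\mathbb{TR}^n$,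 of the set of liftable pairs. *)

theory Defs
  imports
    "HOL-Analysis.Analysis"
    "HOL-Library.Poly_Mapping"
    "HOL-Computational_Algebra.Formal_Laurent_Series"
begin

unbundle no fps_syntax

section \<open>The field of real Puiseux series\<close>

text \<open>
  The Laurent series \<open>F = \<Sum>\<^sub>k F\<^sub>k T\<^sup>k\<close>, read at \<open>T = t\<^sup>1\<^sup>/\<^sup>m\<close>, as the function that sends an
  exponent of \<open>t\<close> to its coefficient. The images of \<open>ramify m\<close> are the fields \<open>\<real>((t\<^sup>1\<^sup>/\<^sup>m))\<close>.
\<close>
definition ramify :: "nat \<Rightarrow> real fls \<Rightarrow> rat \<Rightarrow> real" where
  "ramify m F q = (if of_nat m * q \<in> \<int> then fls_nth F \<lfloor>of_nat m * q\<rfloor> else 0)"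

typedef puiseux = "{f. \<exists>m>0. \<exists>F. f = ramify m F}"
  morphisms pcoeff Abs_puiseux
  by (auto intro: exI[of _ 1])

setup_lifting type_definition_puiseux

lemma ramify_of_int: "m > 0 \<Longrightarrow> ramify m F (of_int k / of_nat m) = fls_nth F k"
  by (simp add: ramify_def)

lemma ramify_cases [consumes 1, case_names int nonint]:
  assumes "m > 0"
  obtains (int) k where "q = of_int k / of_nat m"
    | (nonint) "of_nat m * q \<notin> \<int>" "\<And>F. ramify m F q = 0"
proof (cases "of_nat m * q \<in> \<int>")
  case True
  then obtain k where "of_nat m * q = of_int k" by (auto elim: Ints_cases)
  with assms have "q = of_int k / of_nat m" by (simp add: field_simps)
  then show ?thesis by (rule int)
next
  case False
  then show ?thesis by (intro nonint) (auto simp: ramify_def)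
qed

lemma ramify_inj: "m > 0 \<Longrightarrow> ramify m F = ramify m G \<Longrightarrow> F = G"
proof (rule fls_eqI)
  fix k
  assume "m > 0" "ramify m F = ramify m G"
  then show "fls_nth F k = fls_nth G k"
    using ramify_of_int[of m F k] ramify_of_int[of m G k] by simp
qed

lemma ramify_compose:
  assumes "m > 0" "d > 0"
  shows "ramify m F = ramify (m * d) (fls_compose_power F d)"
proof
  fix q
  have md: "m * d > 0" using assms by simp
  from md show "ramify m F q = ramify (m * d) (fls_compose_power F d) q"
  proof (cases rule: ramify_cases[where q = q])
    case (int k)
    show ?thesis
    proof (cases "int d dvd k")
      case True
      then obtain j where j: "k = int d * j" by blast
      have "q = of_int j / of_nat m" using int j assms by simp
      moreover have "ramify (m * d) (fls_compose_power F d) q = fls_nth F j"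
        unfolding int using assms j by (subst ramify_of_int) (auto simp: fls_nth_compose_power)
      ultimately show ?thesis using assms by (simp add: ramify_of_int)
    next
      case False
      have "of_nat m * q \<notin> \<int>"
      proof
        assume "of_nat m * q \<in> \<int>"
        then obtain j where "of_nat m * q = of_int j" by (auto elim: Ints_cases)
        then have "(of_int k :: rat) = of_int (j * int d)"
          using int assms by (simp add: field_simps)
        then have "k = j * int d" by (simp only: of_int_eq_iff)
        with False show False by simp
      qed
      then have "ramify m F q = 0" by (simp add: ramify_def)
      moreover have "ramify (m * d) (fls_compose_power F d) q = 0"
        unfolding int using assms False by (subst ramify_of_int) (auto simp: fls_nth_compose_power)
      ultimately show ?thesis by simp
    qed
  next
    case nonint
    have "of_nat m * q \<notin> \<int>"
    proof
      assume "of_nat m * q \<in> \<int>"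
      then have "of_nat d * (of_nat m * q) \<in> \<int>" by (rule Ints_mult[OF Ints_of_nat])
      then show False using nonint(1) by (simp add: mult_ac)
    qed
    then show ?thesis using nonint(2) by (simp add: ramify_def)
  qed
qed

lemma ramify_common:
  assumes "f \<in> {f. \<exists>m>0. \<exists>F. f = ramify m F}" "g \<in> {f. \<exists>m>0. \<exists>F. f = ramify m F}"
  obtains m F G where "m > 0" "f = ramify m F" "g = ramify m G"
proof -
  obtain m F where 1: "m > 0" "f = ramify m F" using assms by blast
  obtain n G where 2: "n > 0" "g = ramify n G" using assms by blast
  have "f = ramify (m * n) (fls_compose_power F n)"
    using ramify_compose[OF 1(1) 2(1), of F] 1(2) by simp
  moreover have "g = ramify (m * n) (fls_compose_power G m)"
    using ramify_compose[OF 2(1) 1(1), of G] 2(2) by (simp add: mult.commute)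
  ultimately show ?thesis using 1 2 by (intro that[of "m * n"]) auto
qed

lemma ramify_0: "ramify m 0 = (\<lambda>_. 0)"
  by (auto simp: ramify_def)

lemma ramify_1: "m > 0 \<Longrightarrow> ramify m 1 = (\<lambda>q. if q = 0 then 1 else 0)"
proof
  fix q assume m: "m > 0"
  then show "ramify m 1 q = (if q = 0 then 1 else 0)"
    by (cases rule: ramify_cases[OF m, of q]) (auto simp: ramify_of_int)
qed

lemma ramify_add: "ramify m (F + G) = (\<lambda>q. ramify m F q + ramify m G q)"
  by (auto simp: ramify_def)

lemma ramify_uminus: "ramify m (- F) = (\<lambda>q. - ramify m F q)"
  by (auto simp: ramify_def)

lemma ramify_diff: "ramify m (F - G) = (\<lambda>q. ramify m F q - ramify m G q)"
  by (auto simp: ramify_def)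

text \<open>The Cauchy product; the sum is finite when \<open>f\<close> and \<open>g\<close> are Puiseux series.\<close>
definition conv :: "(rat \<Rightarrow> real) \<Rightarrow> (rat \<Rightarrow> real) \<Rightarrow> rat \<Rightarrow> real" where
  "conv f g q = (\<Sum>a | f a \<noteq> 0 \<and> g (q - a) \<noteq> 0. f a * g (q - a))"

lemma ramify_times:
  assumes "m > 0"
  shows "ramify m (F * G) = conv (ramify m F) (ramify m G)"
proof
  fix q
  from assms show "ramify m (F * G) q = conv (ramify m F) (ramify m G) q"
  proof (cases rule: ramify_cases[where q = q])
    case (int k)
    define N where "N = {a. ramify m F a \<noteq> 0 \<and> ramify m G (q - a) \<noteq> 0}"
    define I where "I = {fls_subdegree F .. k - fls_subdegree G}"
    define h where "h = (\<lambda>i. (of_int i / of_nat m :: rat))"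
    have inj: "inj_on h I" using assms by (auto simp: inj_on_def h_def)
    have qh: "q - h i = h (k - i)" for i by (simp add: h_def int diff_divide_distrib)
    have rh: "ramify m X (h i) = fls_nth X i" for X i
      by (simp add: h_def ramify_of_int assms)
    have sub: "N \<subseteq> h ` I"
    proof
      fix a assume a: "a \<in> N"
      then obtain i where i: "a = h i"
        by (cases rule: ramify_cases[OF assms, of a]) (auto simp: N_def h_def)
      have "fls_nth F i \<noteq> 0" "fls_nth G (k - i) \<noteq> 0"
        using a by (auto simp: i N_def qh rh)
      then have "i \<in> I" unfolding I_def
        using fls_subdegree_leI[of F i] fls_subdegree_leI[of G "k - i"] by auto
      then show "a \<in> h ` I" using i by blast
    qed
    have "conv (ramify m F) (ramify m G) q = (\<Sum>a\<in>N. ramify m F a * ramify m G (q - a))"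
      by (simp add: conv_def N_def)
    also have "\<dots> = (\<Sum>a\<in>h ` I. ramify m F a * ramify m G (q - a))"
      by (rule sum.mono_neutral_left) (use sub in \<open>auto simp: I_def N_def\<close>)
    also have "\<dots> = (\<Sum>i\<in>I. fls_nth F i * fls_nth G (k - i))"
      by (simp add: sum.reindex[OF inj] qh rh)
    also have "\<dots> = fls_nth (F * G) k" by (simp add: fls_times_nth(2) I_def)
    also have "\<dots> = ramify m (F * G) q" by (simp add: int ramify_of_int assms)
    finally show ?thesis by simp
  next
    case nonint
    have "ramify m F a = 0 \<or> ramify m G (q - a) = 0" for a
    proof (rule ccontr)
      assume "\<not> ?thesis"
      then have "of_nat m * a \<in> \<int>" "of_nat m * (q - a) \<in> \<int>"
        by (auto simp: ramify_def split: if_splits)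
      then have "of_nat m * a + of_nat m * (q - a) \<in> \<int>" by (rule Ints_add)
      then show False using nonint(1) by (simp add: algebra_simps)
    qed
    then have "conv (ramify m F) (ramify m G) q = 0"
      unfolding conv_def by (intro sum.neutral) auto
    then show ?thesis using nonint(2) by simp
  qed
qed

lemma closed_under_op:
  assumes "\<exists>m>0. \<exists>F. f = ramify m F" "\<exists>m>0. \<exists>F. g = ramify m F"
    and "\<And>m F G. m > 0 \<Longrightarrow> ramify m (op_fls F G) = op_fun (ramify m F) (ramify m G)"
  shows "\<exists>m>0. \<exists>F. op_fun f g = ramify m F"
proof -
  from assms(1,2) obtain m F G where "m > 0" "f = ramify m F" "g = ramify m G"
    using ramify_common[of f g] by blast
  with assms(3) show ?thesis by metis
qed

instantiation puiseux :: "{zero,one,plus,minus,uminus,times}"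
begin

lift_definition zero_puiseux :: puiseux is "\<lambda>_. 0"
  by (intro exI[of _ "1::nat"] conjI exI[of _ "0::real fls"]) (simp_all only: ramify_0 zero_less_one)

lift_definition one_puiseux :: puiseux is "\<lambda>q. if q = 0 then 1 else 0"
  by (intro exI[of _ "1::nat"] conjI exI[of _ "1::real fls"]) (simp_all only: ramify_1 zero_less_one)

lift_definition plus_puiseux :: "puiseux \<Rightarrow> puiseux \<Rightarrow> puiseux" is "\<lambda>f g q. f q + g q"
  by (rule closed_under_op[of _ _ "(+)" "\<lambda>f g q. f q + g q"], assumption, assumption, simp only: ramify_add)

lift_definition minus_puiseux :: "puiseux \<Rightarrow> puiseux \<Rightarrow> puiseux" is "\<lambda>f g q. f q - g q"
  by (rule closed_under_op[of _ _ "(-)" "\<lambda>f g q. f q - g q"], assumption, assumption, simp only: ramify_diff)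

lift_definition uminus_puiseux :: "puiseux \<Rightarrow> puiseux" is "\<lambda>f q. - f q"
  by (elim exE conjE, rule exI, rule conjI, assumption, rule exI, simp only: ramify_uminus[symmetric])

lift_definition times_puiseux :: "puiseux \<Rightarrow> puiseux \<Rightarrow> puiseux" is conv
  by (rule closed_under_op[of _ _ "(*)" conv], assumption, assumption, simp only: ramify_times)

instance ..

end

definition of_fls :: "nat \<Rightarrow> real fls \<Rightarrow> puiseux" where
  "of_fls m F = Abs_puiseux (ramify m F)"

lemma pcoeff_of_fls: "m > 0 \<Longrightarrow> pcoeff (of_fls m F) = ramify m F"
  unfolding of_fls_def by (rule Abs_puiseux_inverse) blast

lemma of_fls_inj: "m > 0 \<Longrightarrow> of_fls m F = of_fls m G \<longleftrightarrow> F = G"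
  by (metis pcoeff_of_fls ramify_inj)

lemma of_fls_simps:
  assumes "m > 0"
  shows "of_fls m F + of_fls m G = of_fls m (F + G)"
    and "of_fls m F - of_fls m G = of_fls m (F - G)"
    and "- of_fls m F = of_fls m (- F)"
    and "of_fls m F * of_fls m G = of_fls m (F * G)"
    and "0 = of_fls m 0"
    and "1 = of_fls m 1"
  using assms
  by (simp_all add: pcoeff_inject[symmetric] plus_puiseux.rep_eq minus_puiseux.rep_eq
      uminus_puiseux.rep_eq times_puiseux.rep_eq zero_puiseux.rep_eq one_puiseux.rep_eq
      pcoeff_of_fls ramify_add ramify_diff ramify_uminus ramify_times ramify_0 ramify_1)

lemma of_fls_compose: "m > 0 \<Longrightarrow> d > 0 \<Longrightarrow> of_fls m F = of_fls (m * d) (fls_compose_power F d)"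
  by (simp add: of_fls_def flip: ramify_compose)

lemma of_fls_cases: obtains m F where "m > 0" "x = of_fls m F"
proof -
  obtain m F where "m > 0" "pcoeff x = ramify m F" using pcoeff[of x] by blast
  with that[of m F] show ?thesis by (metis of_fls_def pcoeff_inverse)
qed

lemma of_fls_common2:
  obtains m F G where "m > 0" "x = of_fls m F" "y = of_fls m G"
  using ramify_common[OF pcoeff pcoeff, of x y] by (metis of_fls_def pcoeff_inverse)

lemma of_fls_common3:
  obtains m F G H where "m > 0" "x = of_fls m F" "y = of_fls m G" "z = of_fls m H"
proof -
  obtain m F G where 1: "m > 0" "x = of_fls m F" "y = of_fls m G" by (rule of_fls_common2)
  obtain n H where 2: "n > 0" "z = of_fls n H" by (rule of_fls_cases)
  have "z = of_fls (m * n) (fls_compose_power H m)"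
    using of_fls_compose[OF 2(1) 1(1), of H] 2(2) by (simp add: mult.commute)
  with 1 2 show ?thesis
    by (intro that[of "m * n" "fls_compose_power F n" "fls_compose_power G n"
          "fls_compose_power H m"])
       (simp_all add: of_fls_compose[symmetric])
qed

instance puiseux :: comm_ring_1
proof
  fix a b c :: puiseux
  obtain m F G H where *: "m > 0" "a = of_fls m F" "b = of_fls m G" "c = of_fls m H"
    by (rule of_fls_common3)
  note s = of_fls_simps[OF *(1)]
  show "a * b * c = a * (b * c)" "a * b = b * a" "1 * a = a" "(a + b) * c = a * c + b * c"
    "a + b + c = a + (b + c)" "a + b = b + a" "0 + a = a" "- a + a = 0" "a - b = a + - b"
    unfolding * s by (simp_all add: algebra_simps)
  have "(1 :: real fls) \<noteq> 0" by simp
  then show "(0 :: puiseux) \<noteq> 1" by (metis s(5,6) of_fls_inj[OF *(1)])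
qed

instantiation puiseux :: field
begin

definition inverse_puiseux :: "puiseux \<Rightarrow> puiseux" where
  "inverse x = (if x = 0 then 0 else THE y. x * y = 1)" for x :: puiseux

definition divide_puiseux :: "puiseux \<Rightarrow> puiseux \<Rightarrow> puiseux" where
  "x div y = x * inverse y" for x y :: puiseux

instance
proof
  fix a :: puiseux
  assume "a \<noteq> 0"
  obtain m F where *: "m > 0" "a = of_fls m F" by (rule of_fls_cases)
  note s = of_fls_simps[OF *(1)]
  have "F \<noteq> 0" using \<open>a \<noteq> 0\<close> * s(5) by auto
  then have 1: "a * of_fls m (inverse F) = 1" by (simp add: * s)
  have "inverse a = of_fls m (inverse F)"
    unfolding inverse_puiseux_def using \<open>a \<noteq> 0\<close> 1
    by (auto intro!: the_equality) (metis mult.assoc mult.commute mult_1)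
  with 1 show "inverse a * a = 1" by (simp add: mult.commute)
qed (simp_all add: divide_puiseux_def inverse_puiseux_def)

end

text \<open>The least exponent of a nonzero series (unspecified for 0).\<close>
definition val :: "puiseux \<Rightarrow> rat" where
  "val x = (LEAST q. pcoeff x q \<noteq> 0)"

lemma val_of_fls:
  assumes "m > 0" "F \<noteq> 0"
  shows "val (of_fls m F) = of_int (fls_subdegree F) / of_nat m"
  unfolding val_def pcoeff_of_fls[OF assms(1)]
proof (rule Least_equality)
  show "ramify m F (of_int (fls_subdegree F) / of_nat m) \<noteq> 0"
    using assms by (simp add: ramify_of_int)
next
  fix q assume q: "ramify m F q \<noteq> 0"
  from assms(1) show "of_int (fls_subdegree F) / of_nat m \<le> q"
  proof (cases rule: ramify_cases[where q = q])
    case (int k)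
    with q assms have "fls_nth F k \<noteq> 0" by (simp add: ramify_of_int)
    then have "fls_subdegree F \<le> k" by (rule fls_subdegree_leI)
    then show ?thesis unfolding int by (intro divide_right_mono) auto
  next
    case nonint
    with q show ?thesis by simp
  qed
qed

lemma pcoeff_val_of_fls:
  assumes "m > 0"
  shows "pcoeff (of_fls m F) (val (of_fls m F)) = fls_nth F (fls_subdegree F)"
proof (cases "F = 0")
  case True
  then show ?thesis using assms by (simp add: pcoeff_of_fls ramify_0)
next
  case False
  then show ?thesis using assms by (simp add: pcoeff_of_fls val_of_fls ramify_of_int)
qed

instantiation puiseux :: linordered_field
begin

definition less_puiseux :: "puiseux \<Rightarrow> puiseux \<Rightarrow> bool" where
  "x < y \<longleftrightarrow> pcoeff (y - x) (val (y - x)) > 0"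

definition less_eq_puiseux :: "puiseux \<Rightarrow> puiseux \<Rightarrow> bool" where
  "x \<le> y \<longleftrightarrow> x < y \<or> x = y" for x y :: puiseux

definition abs_puiseux :: "puiseux \<Rightarrow> puiseux" where
  "\<bar>x\<bar> = (if x < 0 then - x else x)" for x :: puiseux

definition sgn_puiseux :: "puiseux \<Rightarrow> puiseux" where
  "sgn x = (if x = 0 then 0 else if 0 < x then 1 else - 1)" for x :: puiseux

instance
proof -
  define lc where "lc = (\<lambda>x. pcoeff x (val x))"
  have less: "x < y \<longleftrightarrow> lc (y - x) > 0" for x y
    by (simp add: less_puiseux_def lc_def)
  have lc0: "lc x = 0 \<longleftrightarrow> x = 0" for x
  proof -
    obtain m F where *: "m > 0" "x = of_fls m F" by (rule of_fls_cases)
    have "x = 0 \<longleftrightarrow> F = 0"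
      using of_fls_inj[OF *(1), of F 0] of_fls_simps(5)[OF *(1)] *(2) by simp
    moreover have "lc x = fls_nth F (fls_subdegree F)"
      unfolding lc_def *(2) by (rule pcoeff_val_of_fls[OF *(1)])
    ultimately show ?thesis using nth_fls_subdegree_nonzero[of F] by auto
  qed
  have lcm: "lc (- x) = - lc x" for x
  proof -
    obtain m F where *: "m > 0" "x = of_fls m F" by (rule of_fls_cases)
    show ?thesis unfolding lc_def *(2) of_fls_simps(3)[OF *(1)] pcoeff_val_of_fls[OF *(1)] by simp
  qed
  have lct: "lc (x * y) = lc x * lc y" for x y
  proof -
    obtain m F G where *: "m > 0" "x = of_fls m F" "y = of_fls m G" by (rule of_fls_common2)
    show ?thesis unfolding lc_def *(2,3) of_fls_simps(4)[OF *(1)] pcoeff_val_of_fls[OF *(1)]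
      by (cases "F = 0 \<or> G = 0") auto
  qed
  have lcp: "lc (x + y) > 0" if "lc x > 0" "lc y > 0" for x y
  proof -
    obtain m F G where *: "m > 0" "x = of_fls m F" "y = of_fls m G" by (rule of_fls_common2)
    define d where "d = min (fls_subdegree F) (fls_subdegree G)"
    have FG: "fls_nth F (fls_subdegree F) > 0" "fls_nth G (fls_subdegree G) > 0"
      using that unfolding lc_def *(2,3) pcoeff_val_of_fls[OF *(1)] by auto
    then have "fls_nth F d \<ge> 0" "fls_nth G d \<ge> 0" "fls_nth F d > 0 \<or> fls_nth G d > 0"
      by (auto simp: d_def min_def)
        (metis fls_eq0_below_subdegree linorder_not_le order_less_le order.refl)+
    then have pos: "fls_nth (F + G) d > 0" by auto
    moreover have "fls_nth (F + G) k = 0" if "k < d" for k using that by (simp add: d_def)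
    ultimately have "fls_subdegree (F + G) = d" by (intro fls_subdegree_eqI) auto
    with pos show ?thesis
      unfolding lc_def *(2,3) of_fls_simps(1)[OF *(1)] pcoeff_val_of_fls[OF *(1)] by simp
  qed
  show "OFCLASS(puiseux, linordered_field_class)"
  proof
    fix x y z :: puiseux
    have asym: "\<not> y < x" if "x < y"
      using that lcm[of "x - y"] by (simp add: less)
    have irrefl: "\<not> x < x" using lc0[of 0] by (simp add: less)
    have trans: "x < z" if "x < y" "y < z" for x y z :: puiseux
      using lcp[of "y - x" "z - y"] that by (simp add: less)
    have total: "x < y \<or> x = y \<or> y < x"
      using lcm[of "x - y"] lc0[of "x - y"] by (auto simp: less)
    show "x < y \<longleftrightarrow> x \<le> y \<and> \<not> y \<le> x" using asym irrefl by (auto simp: less_eq_puiseux_def)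
    show "x \<le> x" by (simp add: less_eq_puiseux_def)
    show "x \<le> y \<Longrightarrow> y \<le> z \<Longrightarrow> x \<le> z" using trans by (auto simp: less_eq_puiseux_def)
    show "x \<le> y \<Longrightarrow> y \<le> x \<Longrightarrow> x = y" using asym by (auto simp: less_eq_puiseux_def)
    show "x \<le> y \<or> y \<le> x" using total by (auto simp: less_eq_puiseux_def)
    show "x \<le> y \<Longrightarrow> z + x \<le> z + y" by (auto simp: less_eq_puiseux_def less)
    show "x < y \<Longrightarrow> 0 < z \<Longrightarrow> z * x < z * y"
      using lct[of z "y - x"] by (simp add: less algebra_simps)
    show "\<bar>x\<bar> = (if x < 0 then - x else x)" by (simp add: abs_puiseux_def)
    show "sgn x = (if x = 0 then 0 else if 0 < x then 1 else - 1)" by (simp add: sgn_puiseux_def)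
  qed
qed

end

lemma puiseux_pos_iff: "0 < x \<longleftrightarrow> pcoeff x (val x) > 0"
  by (simp add: less_puiseux_def)


section \<open>Signed tropical numbers\<close>

datatype sign = Plus | Minus

instantiation sign :: discrete_topology
begin

definition open_sign :: "sign set \<Rightarrow> bool" where
  "open_sign S = True"

instance
  by standard (auto simp: open_sign_def)

end

type_synonym tr = "sign \<times> real"

definition trop :: "puiseux \<Rightarrow> tr" where
  "trop x = (if x > 0 then Plus else Minus, real_of_rat (val x))"


section \<open>Multivariate polynomials over the Puiseux series and their singular points\<close>

text \<open>Exponents are vectors in \<open>\<nat>\<^sup>n\<close>, and \<open>'n\<close> is the index type of the variables.\<close>
type_synonym 'n puiseux_poly = "(nat ^ 'n) \<Rightarrow>\<^sub>0 puiseux"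

definition poly_eval :: "'n::finite puiseux_poly \<Rightarrow> puiseux ^ 'n \<Rightarrow> puiseux" where
  "poly_eval F P =
     (\<Sum>l\<in>Poly_Mapping.keys F. Poly_Mapping.lookup F l * (\<Prod>k\<in>UNIV. (P $ k) ^ (l $ k)))"

text \<open>
  If \<open>l $ k = 0\<close>, the truncated exponent \<open>l - axis k 1\<close> is harmless, as its coefficient vanishes.
\<close>
definition partial_deriv :: "'n::finite \<Rightarrow> 'n puiseux_poly \<Rightarrow> 'n puiseux_poly" where
  "partial_deriv k F =
     (\<Sum>l\<in>Poly_Mapping.keys F.
        Poly_Mapping.single (l - axis k 1) (of_nat (l $ k) * Poly_Mapping.lookup F l))"

definition singular_point :: "'n::finite puiseux_poly \<Rightarrow> puiseux ^ 'n \<Rightarrow> bool" where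
  "singular_point F P \<longleftrightarrow>
     poly_eval F P = 0 \<and> (\<forall>k. poly_eval (partial_deriv k F) P = 0)"


section \<open>Singular points of signed tropical hypersurfaces\<close>

text \<open>
  The tropical polynomial \<open>f = \<Oplus>\<^sub>l a\<^sub>l w\<^sup>l\<close> (\<open>l\<close> in \<open>A\<close>) is given by its support \<open>A\<close> and its coefficient
  function \<open>a\<close>. Elements of the product space \<open>TR\<^sup>A\<close> are extensional functions on \<open>A\<close>.
\<close>
definition trop_poly :: "'n::finite puiseux_poly \<Rightarrow> nat ^ 'n \<Rightarrow> tr" where
  "trop_poly F = (\<lambda>l\<in>Poly_Mapping.keys F. trop (Poly_Mapping.lookup F l))"

definition trop_vec :: "puiseux ^ 'n \<Rightarrow> tr ^ 'n::finite" where
  "trop_vec P = (\<chi> k. trop (P $ k))"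

definition liftable_pairs :: "(nat ^ 'n::finite) set \<Rightarrow> ((nat ^ 'n \<Rightarrow> tr) \<times> (tr ^ 'n)) set" where
  "liftable_pairs A =
     {(trop_poly F, trop_vec P) | F P.
        Poly_Mapping.keys F = A \<and> (\<forall>k. P $ k \<noteq> 0) \<and> singular_point F P}"

definition trop_singular :: "(nat ^ 'n::finite) set \<Rightarrow> (nat ^ 'n \<Rightarrow> tr) \<Rightarrow> tr ^ 'n \<Rightarrow> bool" where
  "trop_singular A a p \<longleftrightarrow>
     (restrict a A, p) \<in>
       prod_topology (product_topology (\<lambda>_. euclidean) A) euclidean closure_of liftable_pairs A"


section \<open>Lattices, flags and separation\<close>

definition affine_lattice :: "(nat ^ 'n::finite) set \<Rightarrow> (int ^ 'n) set" where
  "affine_lattice A =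
     {(\<chi> k. \<Sum>l\<in>A. z l * int (l $ k)) | z :: nat ^ 'n \<Rightarrow> int. (\<Sum>l\<in>A. z l) = 1}"

definition real_vec :: "nat ^ 'n \<Rightarrow> real ^ 'n::finite" where
  "real_vec l = (\<chi> k. real (l $ k))"

definition modulus_vec :: "tr ^ 'n \<Rightarrow> real ^ 'n::finite" where
  "modulus_vec p = (\<chi> k. snd (p $ k))"

definition trop_weight :: "(nat ^ 'n::finite \<Rightarrow> tr) \<Rightarrow> tr ^ 'n \<Rightarrow> nat ^ 'n \<Rightarrow> real" where
  "trop_weight a p l = snd (a l) + real_vec l \<bullet> modulus_vec p"

text \<open>
  The indices are shifted by one: \<open>flag A a p i\<close> is \<open>\<F>\<close> with index \<open>i - 1\<close>, so that
  \<open>flag A a p 0\<close> is the empty set. Beyond the index where the process stops, \<open>flag\<close> is constant.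
\<close>
primrec flag ::
  "(nat ^ 'n::finite) set \<Rightarrow> (nat ^ 'n \<Rightarrow> tr) \<Rightarrow> tr ^ 'n \<Rightarrow> nat \<Rightarrow> (nat ^ 'n) set" where
  "flag A a p 0 = {}"
| "flag A a p (Suc i) = flag A a p i \<union>
     {j. is_arg_min (trop_weight a p)
           (\<lambda>j. j \<in> A \<and> real_vec j \<notin> affine hull (real_vec ` flag A a p i)) j}"

text \<open>
  The index \<open>r\<close> at which the flag stops. It exists if the affine span of \<open>A\<close> is the whole space,
  in particular if the affine lattice generated by \<open>A\<close> is \<open>\<int>\<^sup>n\<close>.
\<close>
definition flag_stop :: "(nat ^ 'n::finite) set \<Rightarrow> (nat ^ 'n \<Rightarrow> tr) \<Rightarrow> tr ^ 'n \<Rightarrow> nat" where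
  "flag_stop A a p = (LEAST r. aff_dim (real_vec ` flag A a p (Suc r)) = int CARD('n))"

definition signed_part :: "sign \<Rightarrow> (nat ^ 'n \<Rightarrow> tr) \<Rightarrow> (nat ^ 'n) set \<Rightarrow> (real ^ 'n::finite) set" where
  "signed_part s a S = real_vec ` {l \<in> S. fst (a l) = s}"

definition hyperplane :: "('a::euclidean_space) set \<Rightarrow> bool" where
  "hyperplane L \<longleftrightarrow> (\<exists>v c. v \<noteq> 0 \<and> L = {x. v \<bullet> x = c})"

definition separates :: "('a::euclidean_space) set \<Rightarrow> 'a set \<Rightarrow> 'a set \<Rightarrow> bool" where
  "separates L B C \<longleftrightarrow>
     \<not> B \<union> C \<subseteq> L \<and>
     (\<exists>v c. v \<noteq> 0 \<and> L = {x. v \<bullet> x = c} \<and>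
        (B \<subseteq> {x. v \<bullet> x \<ge> c} \<and> C \<subseteq> {x. v \<bullet> x \<le> c} \<or>
         B \<subseteq> {x. v \<bullet> x \<le> c} \<and> C \<subseteq> {x. v \<bullet> x \<ge> c}))"

end

theory Submission
  imports Defs
begin

text \<open>
  At a point \<open>P\<close> with nonzero coordinates, \<open>F = \<Sum> c\<^sub>l x\<^sup>l\<close> is singular iff the terms \<open>b\<^sub>l = c\<^sub>l P\<^sup>l\<close> form an
  affine dependency: \<open>\<Sum> b\<^sub>l (1, l) = 0\<close>. If \<open>P\<close> is positive, \<open>b\<^sub>l\<close> has the sign of \<open>c\<^sub>l\<close> and its valuation
  is the weight \<open>|a\<^sub>l| + \<langle>l, |p|\<rangle>\<close>. So the question is which signs and weights an affine dependency
  over the Puiseux series can have. They are exactly the balanced ones: no affine functional that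
  vanishes on all exponents of weight below \<open>v\<close> separates the two signs on the exponents of weight
  \<open>v\<close>. Necessity follows from the coefficient of \<open>t\<^sup>v\<close>; conversely Farkas' lemma gives, for each
  level \<open>v\<close>, a real dependency \<open>d\<^sup>v\<close> supported in weights at most \<open>v\<close> with the prescribed signs at weight
  \<open>v\<close>, and \<open>\<Sum>\<^sub>v t\<^sup>v d\<^sup>v\<close> is the required dependency. Balancedness survives any coarsening of
  the order of the weights, so it is a closed condition and rational approximations by rounding
  suffice. It agrees with the condition on the flag since the first flag member not contained in a
  hyperplane adds exponents of minimal weight outside the span of the previous members.
\<close>

section \<open>Sign vectors and orderings of a vector configuration\<close>

text \<open>For signs \<open>\<sigma>\<close> and constant \<open>w\<close> this is the condition of
  Stiemke's theorem for a linear dependency whose coefficients have exactly the signs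
  \<open>\<sigma>\<close>. Only the order of the values of \<open>w\<close> enters; the type
  \<open>'w\<close> is left open because both rational valuations and real weights occur.\<close>

definition balanced ::
  "'i set \<Rightarrow> ('i \<Rightarrow> 'e::real_inner) \<Rightarrow> ('i \<Rightarrow> real) \<Rightarrow> ('i \<Rightarrow> 'w::linorder) \<Rightarrow> bool" where
  "balanced A x \<sigma> w \<longleftrightarrow>
     (\<forall>z v. (\<forall>l\<in>A. w l < v \<longrightarrow> z \<bullet> x l = 0) \<longrightarrow> (\<forall>l\<in>A. w l = v \<longrightarrow> 0 \<le> \<sigma> l * (z \<bullet> x l)) \<longrightarrow>
        (\<forall>l\<in>A. w l = v \<longrightarrow> z \<bullet> x l = 0))"

lemma balancedI:
  assumes "\<And>z v l. (\<And>j. j \<in> A \<Longrightarrow> w j < v \<Longrightarrow> z \<bullet> x j = 0) \<Longrightarrow>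
     (\<And>j. j \<in> A \<Longrightarrow> w j = v \<Longrightarrow> 0 \<le> \<sigma> j * (z \<bullet> x j)) \<Longrightarrow> l \<in> A \<Longrightarrow> w l = v \<Longrightarrow> z \<bullet> x l = 0"
  shows "balanced A x \<sigma> w"
  using assms unfolding balanced_def by blast

lemma balancedD:
  assumes "balanced A x \<sigma> w"
    and "\<And>j. j \<in> A \<Longrightarrow> w j < v \<Longrightarrow> z \<bullet> x j = 0"
    and "\<And>j. j \<in> A \<Longrightarrow> w j = v \<Longrightarrow> 0 \<le> \<sigma> j * (z \<bullet> x j)"
    and "l \<in> A" "w l = v"
  shows "z \<bullet> x l = 0"
  using assms unfolding balanced_def by blast

lemma balanced_sign_cong:
  assumes "balanced A x \<sigma> w" "\<And>l. l \<in> A \<Longrightarrow> \<sigma> l = \<sigma>' l"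
  shows "balanced A x \<sigma>' w"
proof (rule balancedI)
  fix z v l
  assume "\<And>j. j \<in> A \<Longrightarrow> w j < v \<Longrightarrow> z \<bullet> x j = 0" "l \<in> A" "w l = v"
    and "\<And>j. j \<in> A \<Longrightarrow> w j = v \<Longrightarrow> 0 \<le> \<sigma>' j * (z \<bullet> x j)"
  then show "z \<bullet> x l = 0"
    using assms(2) by (intro balancedD[OF assms(1), of v z l]) simp_all
qed

text \<open>The order by \<open>w\<close> may break ties of \<open>w'\<close>. Given a functional
  \<open>z\<close> that violates the condition for \<open>w'\<close> at level \<open>v\<close>, the
  vectors of least \<open>w\<close> among those where \<open>z\<close> does not vanish all lie on
  level \<open>v\<close> of \<open>w'\<close>, so \<open>z\<close> already violates the condition
  for \<open>w\<close>.\<close>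

lemma balanced_coarsen:
  fixes w :: "'i \<Rightarrow> 'w::linorder" and w' :: "'i \<Rightarrow> 'v::linorder"
  assumes "finite A" "balanced A x \<sigma> w"
    and mono: "\<And>l j. l \<in> A \<Longrightarrow> j \<in> A \<Longrightarrow> w' l < w' j \<Longrightarrow> w l < w j"
  shows "balanced A x \<sigma> w'"
proof (rule balancedI, rule ccontr)
  fix z v l
  assume lt: "\<And>j. j \<in> A \<Longrightarrow> w' j < v \<Longrightarrow> z \<bullet> x j = 0"
    and eq: "\<And>j. j \<in> A \<Longrightarrow> w' j = v \<Longrightarrow> 0 \<le> \<sigma> j * (z \<bullet> x j)"
    and l: "l \<in> A" "w' l = v" "z \<bullet> x l \<noteq> 0"
  define B where "B = {j \<in> A. z \<bullet> x j \<noteq> 0}"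
  have B: "finite B" "B \<noteq> {}" using assms(1) l by (auto simp: B_def)
  have "Min (w ` B) \<in> w ` B" using B by simp
  then obtain m where m: "m \<in> B" "w m = Min (w ` B)" by (metis imageE)
  have min: "w m \<le> w j" if "j \<in> B" for j using B m that by simp
  \<comment> \<open>Below \<open>v\<close> the functional vanishes. Above \<open>v\<close>,
    \<open>mono\<close> would put \<open>l\<close> strictly before \<open>j\<close> in the order by
    \<open>w\<close>, against the minimality of \<open>m\<close>.\<close>
  have inB: "w' j = v" if "j \<in> B" "w j = w m" for j
  proof (rule ccontr)
    assume "w' j \<noteq> v"
    moreover have "\<not> w' j < v" using lt[of j] that by (auto simp: B_def)
    ultimately have "w' l < w' j" using l by auto
    then have "w l < w j" using mono[of l j] l that by (auto simp: B_def)
    moreover have "w m \<le> w l" using min[of l] l by (auto simp: B_def)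
    ultimately show False using that by simp
  qed
  have "z \<bullet> x m = 0"
  proof (rule balancedD[OF assms(2), where v = "w m"])
    show "z \<bullet> x j = 0" if "j \<in> A" "w j < w m" for j
      using min[of j] that by (cases "z \<bullet> x j = 0") (auto simp: B_def)
    show "0 \<le> \<sigma> j * (z \<bullet> x j)" if "j \<in> A" "w j = w m" for j
      using inB[of j] eq[of j] that by (cases "z \<bullet> x j = 0") (auto simp: B_def)
  qed (use m in \<open>auto simp: B_def\<close>)
  with m show False by (simp add: B_def)
qed

section \<open>Farkas' lemma and real dependencies with prescribed signs\<close>

text \<open>A finitely generated convex cone is closed, so a point outside it is strictly separated
  from it by a hyperplane. Invariance of the cone under scaling makes the normal \<open>z\<close>
  nonnegative on all generators, while \<open>z\<close> is negative at the point.\<close>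

lemma farkas:
  fixes g :: "'i \<Rightarrow> 'e::euclidean_space"
  assumes "finite I" "\<And>z. (\<And>i. i \<in> I \<Longrightarrow> 0 \<le> z \<bullet> g i) \<Longrightarrow> 0 \<le> z \<bullet> y"
  shows "\<exists>c. (\<forall>i\<in>I. 0 \<le> c i) \<and> y = (\<Sum>i\<in>I. c i *\<^sub>R g i)"
proof -
  define K where "K = convex_cone hull (g ` I)"
  define C where "C = {\<Sum>i\<in>I. c i *\<^sub>R g i | c. \<forall>i\<in>I. 0 \<le> c i}"
  have "y \<in> K"
  proof (rule ccontr)
    assume "y \<notin> K"
    moreover have "convex K" "closed K"
      using assms(1) by (simp_all add: K_def convex_convex_cone_hull closed_convex_cone_hull)
    ultimately obtain z b where zb: "z \<bullet> y < b" "\<And>u. u \<in> K \<Longrightarrow> b < z \<bullet> u"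
      using separating_hyperplane_closed_point by meson
    have "b < 0" using zb(2)[of 0] by (simp add: K_def convex_cone_hull_contains_0)
    have "0 \<le> z \<bullet> g i" if "i \<in> I" for i
    proof (rule ccontr)
      assume neg: "\<not> 0 \<le> z \<bullet> g i"
      \<comment> \<open>The factor is positive and chosen so that \<open>z\<close> takes the value
        \<open>b\<close> exactly, although it exceeds \<open>b\<close> on all of
        \<open>K\<close>.\<close>
      have "(b / (z \<bullet> g i)) *\<^sub>R g i \<in> K"
        unfolding K_def using neg \<open>b < 0\<close> that
        by (intro convex_cone_hull_mul hull_inc) (auto simp: divide_nonpos_nonpos)
      from zb(2)[OF this] neg show False by simp
    qed
    then have "0 \<le> z \<bullet> y" by (rule assms(2))
    with zb(1) \<open>b < 0\<close> show False by simp
  qed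
  moreover have "K \<subseteq> C" unfolding K_def
  proof (rule hull_minimal)
    show "g ` I \<subseteq> C"
    proof
      fix u assume "u \<in> g ` I"
      then obtain i where i: "i \<in> I" "u = g i" by blast
      have "(\<Sum>j\<in>I. (if j = i then 1 else 0) *\<^sub>R g j) = u"
        using assms(1) i by (simp add: if_distrib[of "\<lambda>c. c *\<^sub>R _"] cong: if_cong)
      then show "u \<in> C" unfolding C_def by (auto intro!: exI[of _ "\<lambda>j. if j = i then 1 else 0"])
    qed
    show "convex_cone C" unfolding convex_cone_iff
    proof (intro conjI ballI allI impI)
      show "0 \<in> C" unfolding C_def by (auto intro!: exI[of _ "\<lambda>_. 0"])
    next
      fix u v assume "u \<in> C" "v \<in> C"
      then obtain c d where "u = (\<Sum>i\<in>I. c i *\<^sub>R g i)" "v = (\<Sum>i\<in>I. d i *\<^sub>R g i)"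
        "\<forall>i\<in>I. 0 \<le> c i" "\<forall>i\<in>I. 0 \<le> d i" unfolding C_def by blast
      then show "u + v \<in> C" unfolding C_def
        by (auto intro!: exI[of _ "\<lambda>i. c i + d i"] simp: scaleR_left_distrib sum.distrib)
    next
      fix u and r :: real assume "u \<in> C" "0 \<le> r"
      then obtain c where "u = (\<Sum>i\<in>I. c i *\<^sub>R g i)" "\<forall>i\<in>I. 0 \<le> c i" unfolding C_def by blast
      with \<open>0 \<le> r\<close> show "r *\<^sub>R u \<in> C" unfolding C_def
        by (auto intro!: exI[of _ "\<lambda>i. r * c i"] simp: scaleR_sum_right)
    qed
  qed
  ultimately show ?thesis unfolding C_def by blast
qed

text \<open>For each \<open>m\<close> on level \<open>v\<close>, Farkas' lemma writes
  \<open>- \<sigma> m *\<^sub>R x m\<close> as a combination with free coefficients below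
  \<open>v\<close> and coefficients of weakly correct sign on level \<open>v\<close>. This yields a
  dependency with strictly correct sign at \<open>m\<close>; summing over all such \<open>m\<close>
  makes every sign on the level strict.\<close>

lemma balanced_dependency:
  fixes x :: "'i \<Rightarrow> 'e::euclidean_space" and w :: "'i \<Rightarrow> 'w::linorder"
  assumes "finite A" "balanced A x \<sigma> w" and \<sigma>: "\<And>l. \<bar>\<sigma> l\<bar> = 1"
  obtains d where "\<And>l. l \<in> A \<Longrightarrow> w l = v \<Longrightarrow> 0 < \<sigma> l * d l"
    "\<And>l. l \<in> A \<Longrightarrow> v < w l \<Longrightarrow> d l = 0" "(\<Sum>l\<in>A. d l *\<^sub>R x l) = 0"
proof -
  have \<sigma>2: "\<sigma> l * \<sigma> l = 1" for l using \<sigma>[of l] by (auto simp: abs_if split: if_splits)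
  define B where "B = {l \<in> A. w l \<le> v}"
  \<comment> \<open>Each vector is used twice as a generator. Below \<open>v\<close> the two copies
    have opposite signs, so their joint coefficient is free; on level \<open>v\<close> both carry
    the prescribed sign.\<close>
  define \<kappa> where "\<kappa> = (\<lambda>(b, l). if w l = v then \<sigma> l else if b then 1 else - 1 :: real)"
  have single: "\<exists>d. (\<forall>l\<in>A. w l = v \<longrightarrow> 0 \<le> \<sigma> l * d l) \<and> 0 < \<sigma> m * d m \<and>
      (\<forall>l\<in>A. v < w l \<longrightarrow> d l = 0) \<and> (\<Sum>l\<in>A. d l *\<^sub>R x l) = 0" if m: "m \<in> A" "w m = v" for m
  proof -
    \<comment> \<open>A functional that is nonnegative on all generators vanishes below
      \<open>v\<close> and has the right signs on \<open>v\<close>. Balancedness then makes it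
      vanish at \<open>x m\<close>, which is more than Farkas' lemma asks for.\<close>
    have nonneg: "0 \<le> z \<bullet> (- \<sigma> m *\<^sub>R x m)"
      if z: "\<And>i. i \<in> (UNIV :: bool set) \<times> B \<Longrightarrow> 0 \<le> z \<bullet> (\<kappa> i *\<^sub>R x (snd i))" for z
    proof -
      have "z \<bullet> x m = 0"
      proof (rule balancedD[OF assms(2) _ _ m])
        show "z \<bullet> x j = 0" if "j \<in> A" "w j < v" for j
        proof -
          have "j \<in> B" "w j \<noteq> v" using that by (auto simp: B_def)
          then show ?thesis using z[of "(True, j)"] z[of "(False, j)"] by (simp add: \<kappa>_def)
        qed
        show "0 \<le> \<sigma> j * (z \<bullet> x j)" if "j \<in> A" "w j = v" for j
          using z[of "(True, j)"] that by (auto simp: B_def \<kappa>_def)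
      qed
      then show ?thesis by simp
    qed
    have "finite ((UNIV :: bool set) \<times> B)" using assms(1) by (simp add: B_def)
    then have "\<exists>c. (\<forall>i\<in>UNIV \<times> B. 0 \<le> c i) \<and>
        - \<sigma> m *\<^sub>R x m = (\<Sum>i\<in>UNIV \<times> B. c i *\<^sub>R (\<kappa> i *\<^sub>R x (snd i)))"
      by (rule farkas) (rule nonneg)
    then obtain c where c: "\<forall>i\<in>UNIV \<times> B. 0 \<le> c i"
      and sum: "- \<sigma> m *\<^sub>R x m = (\<Sum>i\<in>UNIV \<times> B. c i *\<^sub>R (\<kappa> i *\<^sub>R x (snd i)))"
      by (elim exE conjE)
    define e where "e l = (if l \<in> B then (\<Sum>b\<in>UNIV. c (b, l) * \<kappa> (b, l)) else 0)" for l
    \<comment> \<open>Moving \<open>- \<sigma> m *\<^sub>R x m\<close> to the other side adds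
      \<open>\<sigma> m\<close> to the coefficient at \<open>m\<close>, which makes its sign
      strict.\<close>
    define d where "d l = e l + (if l = m then \<sigma> m else 0)" for l
    have nonneg: "0 \<le> \<sigma> l * e l" if "l \<in> A" "w l = v" for l
    proof -
      have "e l = (c (True, l) + c (False, l)) * \<sigma> l"
        using that by (simp add: e_def B_def \<kappa>_def UNIV_bool distrib_right)
      then have "\<sigma> l * e l = (c (True, l) + c (False, l)) * (\<sigma> l * \<sigma> l)" by (simp only: mult_ac)
      then have "\<sigma> l * e l = c (True, l) + c (False, l)" by (simp only: \<sigma>2 mult_1_right)
      then show ?thesis using c that by (simp add: B_def)
    qed
    have "(\<Sum>i\<in>UNIV \<times> B. c i *\<^sub>R (\<kappa> i *\<^sub>R x (snd i))) =
        (\<Sum>b\<in>UNIV. \<Sum>l\<in>B. (c (b, l) * \<kappa> (b, l)) *\<^sub>R x l)"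
      by (simp add: sum.cartesian_product case_prod_unfold)
    also have "\<dots> = (\<Sum>l\<in>B. e l *\<^sub>R x l)"
      by (subst sum.swap) (simp add: e_def scaleR_sum_left)
    also have "\<dots> = (\<Sum>l\<in>A. e l *\<^sub>R x l)"
      by (rule sum.mono_neutral_left) (auto simp: e_def B_def assms(1))
    finally have "(\<Sum>l\<in>A. e l *\<^sub>R x l) = - \<sigma> m *\<^sub>R x m" using sum by simp
    moreover have "(\<Sum>l\<in>A. d l *\<^sub>R x l) = (\<Sum>l\<in>A. e l *\<^sub>R x l) + \<sigma> m *\<^sub>R x m"
      using assms(1) m by (simp add: d_def scaleR_left_distrib sum.distrib
          if_distrib[of "\<lambda>c. c *\<^sub>R _"] cong: if_cong)
    ultimately have "(\<Sum>l\<in>A. d l *\<^sub>R x l) = 0" by simp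
    moreover have "\<forall>l\<in>A. w l = v \<longrightarrow> 0 \<le> \<sigma> l * d l"
      using nonneg \<sigma>2 by (auto simp: d_def distrib_left intro!: add_nonneg_nonneg)
    moreover have "0 < \<sigma> m * d m"
      using nonneg[of m] m \<sigma>2[of m] by (simp add: d_def distrib_left)
    moreover have "\<forall>l\<in>A. v < w l \<longrightarrow> d l = 0"
      using m by (auto simp: d_def e_def B_def)
    ultimately show ?thesis by blast
  qed
  define Av where "Av = {m \<in> A. w m = v}"
  have fin: "finite Av" using assms(1) by (simp add: Av_def)
  have "\<forall>m\<in>Av. \<exists>d. (\<forall>l\<in>A. w l = v \<longrightarrow> 0 \<le> \<sigma> l * d l) \<and> 0 < \<sigma> m * d m \<and>
      (\<forall>l\<in>A. v < w l \<longrightarrow> d l = 0) \<and> (\<Sum>l\<in>A. d l *\<^sub>R x l) = 0"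
    using single by (auto simp: Av_def)
  then obtain D where D: "\<forall>m\<in>Av. (\<forall>l\<in>A. w l = v \<longrightarrow> 0 \<le> \<sigma> l * D m l) \<and> 0 < \<sigma> m * D m m \<and>
      (\<forall>l\<in>A. v < w l \<longrightarrow> D m l = 0) \<and> (\<Sum>l\<in>A. D m l *\<^sub>R x l) = 0"
    by metis
  show ?thesis
  proof (rule that[of "\<lambda>l. \<Sum>m\<in>Av. D m l"])
    show "0 < \<sigma> l * (\<Sum>m\<in>Av. D m l)" if "l \<in> A" "w l = v" for l
      unfolding sum_distrib_left
      by (rule sum_pos2[of Av l]) (use fin that D in \<open>auto simp: Av_def\<close>)
    show "(\<Sum>m\<in>Av. D m l) = 0" if "l \<in> A" "v < w l" for l
      using D that by (intro sum.neutral) auto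
    have "(\<Sum>l\<in>A. (\<Sum>m\<in>Av. D m l) *\<^sub>R x l) = (\<Sum>m\<in>Av. \<Sum>l\<in>A. D m l *\<^sub>R x l)"
      by (subst sum.swap) (simp add: scaleR_sum_left)
    also have "\<dots> = 0" using D by simp
    finally show "(\<Sum>l\<in>A. (\<Sum>m\<in>Av. D m l) *\<^sub>R x l) = 0" .
  qed
qed

section \<open>Coefficients, valuations and signs of Puiseux series\<close>

lemma pcoeff_sum: "pcoeff (\<Sum>i\<in>I. f i) q = (\<Sum>i\<in>I. pcoeff (f i) q)"
  by (induction I rule: infinite_finite_induct) (simp_all add: zero_puiseux.rep_eq plus_puiseux.rep_eq)

lemma pcoeff_of_nat_mult: "pcoeff (of_nat n * x) q = of_nat n * pcoeff x q"
  by (induction n) (simp_all add: zero_puiseux.rep_eq plus_puiseux.rep_eq distrib_right)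

lemma of_fls_eq_0_iff: "m > 0 \<Longrightarrow> of_fls m F = 0 \<longleftrightarrow> F = 0"
  by (metis of_fls_inj of_fls_simps(5))

lemma pcoeff_val_nonzero:
  assumes "x \<noteq> 0"
  shows "pcoeff x (val x) \<noteq> 0"
proof -
  obtain m F where *: "m > 0" "x = of_fls m F" by (rule of_fls_cases)
  with assms show ?thesis by (simp add: pcoeff_val_of_fls of_fls_eq_0_iff)
qed

lemma pcoeff_eq_0_below_val:
  assumes "q < val x"
  shows "pcoeff x q = 0"
proof -
  obtain m F where *: "m > 0" "x = of_fls m F" by (rule of_fls_cases)
  show ?thesis
  proof (cases "F = 0")
    case True
    then show ?thesis using * by (simp add: pcoeff_of_fls ramify_0)
  next
    case False
    show ?thesis using *(1)
    proof (cases rule: ramify_cases[where q = q])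
      case (int k)
      with assms * False have "k < fls_subdegree F"
        by (simp add: val_of_fls divide_less_cancel)
      with * int show ?thesis by (simp add: pcoeff_of_fls ramify_of_int)
    next
      case nonint
      with * show ?thesis by (simp add: pcoeff_of_fls)
    qed
  qed
qed

lemma val_eqI:
  assumes "pcoeff x q \<noteq> 0" "\<And>r. r < q \<Longrightarrow> pcoeff x r = 0"
  shows "val x = q"
  unfolding val_def using assms by (intro Least_equality) (auto simp: not_less[symmetric])

lemma val_mult:
  assumes "x \<noteq> 0" "y \<noteq> 0"
  shows "val (x * y) = val x + val y"
proof -
  obtain m F G where *: "m > 0" "x = of_fls m F" "y = of_fls m G" by (rule of_fls_common2)
  with assms show ?thesis
    by (simp add: of_fls_simps(4) of_fls_eq_0_iff val_of_fls add_divide_distrib)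
qed

lemma val_1: "val 1 = 0"
  by (rule val_eqI) (auto simp: one_puiseux.rep_eq)

lemma val_power: "x \<noteq> 0 \<Longrightarrow> val (x ^ n) = of_nat n * val x"
  by (induction n) (simp_all add: val_1 val_mult algebra_simps)

lemma val_prod:
  assumes "\<And>i. i \<in> I \<Longrightarrow> f i \<noteq> 0"
  shows "val (\<Prod>i\<in>I. f i) = (\<Sum>i\<in>I. val (f i))"
  using assms by (induction I rule: infinite_finite_induct) (auto simp: val_1 val_mult)

section \<open>Leading signs and monomials\<close>

definition sign_real :: "sign \<Rightarrow> real" where
  "sign_real s = (case s of Plus \<Rightarrow> 1 | Minus \<Rightarrow> - 1)"

lemma sign_real_simps [simp]: "sign_real Plus = 1" "sign_real Minus = - 1" "\<bar>sign_real s\<bar> = 1"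
  by (auto simp: sign_real_def split: sign.split)

lemma sign_real_lead_pos:
  assumes "x \<noteq> 0"
  shows "0 < sign_real (fst (trop x)) * pcoeff x (val x)"
  using pcoeff_val_nonzero[OF assms] by (auto simp: trop_def puiseux_pos_iff)

lemma fst_trop_eqI:
  assumes "0 < sign_real s * pcoeff x (val x)"
  shows "fst (trop x) = s"
  using assms by (cases s) (auto simp: trop_def puiseux_pos_iff)

text \<open>The monomial with coefficient \<open>c\<close> and exponent \<open>q\<close>, built as a
  Laurent monomial in the root of \<open>t\<close> given by the denominator of
  \<open>q\<close>.\<close>

definition puiseux_monom :: "rat \<Rightarrow> real \<Rightarrow> puiseux" where
  "puiseux_monom q c =
     of_fls (nat (snd (quotient_of q))) (fls_const c * fls_X_intpow (fst (quotient_of q)))"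

lemma pcoeff_puiseux_monom: "pcoeff (puiseux_monom q c) r = (if r = q then c else 0)"
proof -
  obtain k n where kn: "quotient_of q = (k, n)" by (cases "quotient_of q")
  have n: "n > 0" and q: "q = of_int k / of_int n"
    using quotient_of_denom_pos[OF kn] quotient_of_div[OF kn] by auto
  define m where "m = nat n"
  have m: "m > 0" and q': "q = of_int k / of_nat m" using n q by (auto simp: m_def)
  have *: "puiseux_monom q c = of_fls m (fls_const c * fls_X_intpow k)"
    by (simp add: puiseux_monom_def kn m_def)
  from m show ?thesis
  proof (cases rule: ramify_cases[where q = r])
    case (int j)
    have "pcoeff (puiseux_monom q c) r = fls_nth (fls_const c * fls_X_intpow k) j"
      unfolding * pcoeff_of_fls[OF m] int by (rule ramify_of_int[OF m])
    moreover have "r = q \<longleftrightarrow> j = k" unfolding int q' using m by simp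
    ultimately show ?thesis by simp
  next
    case nonint
    then have "r \<noteq> q" using q' m by auto
    with nonint m show ?thesis unfolding * by (simp add: pcoeff_of_fls)
  qed
qed

lemma puiseux_monom_1: "0 < puiseux_monom q 1" "val (puiseux_monom q 1) = q"
proof -
  show "val (puiseux_monom q 1) = q" by (rule val_eqI) (auto simp: pcoeff_puiseux_monom)
  then show "0 < puiseux_monom q 1" by (simp add: puiseux_pos_iff pcoeff_puiseux_monom)
qed

section \<open>Puiseux-valued affine dependencies\<close>

text \<open>Homogenisation: linear functionals on these vectors are affine functionals on the
  exponents, and linear dependencies are affine dependencies.\<close>

definition hom_vec :: "nat ^ 'n::finite \<Rightarrow> real \<times> (real ^ 'n)" where
  "hom_vec l = (1, real_vec l)"

definition puiseux_dependency :: "(nat ^ 'n::finite) set \<Rightarrow> (nat ^ 'n \<Rightarrow> puiseux) \<Rightarrow> bool" where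
  "puiseux_dependency A b \<longleftrightarrow>
     (\<Sum>l\<in>A. b l) = 0 \<and> (\<forall>k. (\<Sum>l\<in>A. of_nat (l $ k) * b l) = 0)"

text \<open>Taking the coefficient of a fixed power of \<open>t\<close> is linear and commutes with
  the integer factors \<open>l $ k\<close>. Hence a dependency over the series is a family of real
  dependencies, one for each power.\<close>

lemma puiseux_dependency_iff:
  "puiseux_dependency A b \<longleftrightarrow> (\<forall>q. (\<Sum>l\<in>A. pcoeff (b l) q *\<^sub>R hom_vec l) = 0)"
proof -
  have zero: "x = 0 \<longleftrightarrow> (\<forall>q. pcoeff x q = 0)" for x
    by (metis ext pcoeff_inject zero_puiseux.rep_eq)
  show ?thesis
    unfolding puiseux_dependency_def zero prod_eq_iff vec_eq_iff
    by (auto simp: pcoeff_sum pcoeff_of_nat_mult hom_vec_def real_vec_def fst_sum snd_sum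
        mult.commute[of "pcoeff _ _"])
qed

text \<open>Pair \<open>z\<close> with the real dependency formed by the coefficients at exponent
  \<open>v\<close>. All summands are nonnegative and their sum is zero, so each is zero; on level
  \<open>v\<close> the coefficient is a leading one, hence nonzero, and \<open>z\<close> must
  vanish.\<close>

lemma balanced_puiseux_dependency:
  assumes "finite A" "\<And>l. l \<in> A \<Longrightarrow> b l \<noteq> 0" "puiseux_dependency A b"
  shows "balanced A hom_vec (\<lambda>l. sign_real (fst (trop (b l)))) (\<lambda>l. val (b l))"
proof (rule balancedI)
  fix z v l
  assume lt: "\<And>j. j \<in> A \<Longrightarrow> val (b j) < v \<Longrightarrow> z \<bullet> hom_vec j = 0"
    and eq: "\<And>j. j \<in> A \<Longrightarrow> val (b j) = v \<Longrightarrow> 0 \<le> sign_real (fst (trop (b j))) * (z \<bullet> hom_vec j)"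
    and l: "l \<in> A" "val (b l) = v"
  \<comment> \<open>Below level \<open>v\<close> the functional vanishes, above it the coefficient
    vanishes, and on it the leading coefficient has the sign of \<open>b j\<close>.\<close>
  have nonneg: "0 \<le> pcoeff (b j) v * (z \<bullet> hom_vec j)" if j: "j \<in> A" for j
  proof (cases "val (b j)" v rule: linorder_cases)
    case less
    then show ?thesis using lt j by simp
  next
    case equal
    then show ?thesis using eq[OF j] sign_real_lead_pos[of "b j"] assms(2)[OF j]
      by (cases "fst (trop (b j))") (auto simp: zero_le_mult_iff mult_nonpos_nonpos)
  next
    case greater
    then show ?thesis by (simp add: pcoeff_eq_0_below_val)
  qed
  have "(\<Sum>j\<in>A. pcoeff (b j) v * (z \<bullet> hom_vec j)) = z \<bullet> (\<Sum>j\<in>A. pcoeff (b j) v *\<^sub>R hom_vec j)"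
    by (simp add: inner_sum_right)
  also have "\<dots> = 0" using assms(3) by (simp add: puiseux_dependency_iff)
  finally have "pcoeff (b l) v * (z \<bullet> hom_vec l) = 0"
    using l nonneg sum_nonneg_eq_0_iff[OF assms(1)] by meson
  moreover have "pcoeff (b l) v \<noteq> 0" using l assms(2) pcoeff_val_nonzero by blast
  ultimately show "z \<bullet> hom_vec l = 0" by simp
qed

text \<open>Superpose the real dependencies of all levels, the one of level \<open>v\<close>
  multiplied by the power of \<open>t\<close> with exponent \<open>v\<close>. It does not involve
  exponents of larger weight, so the series at \<open>l\<close> starts at \<open>w l\<close>, with
  the coefficient whose sign is prescribed.\<close>

lemma balanced_imp_puiseux_dependency:
  fixes A :: "(nat ^ 'n::finite) set"
  assumes "finite A" "balanced A hom_vec (\<lambda>l. sign_real (s l)) w"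
  obtains b where "\<And>l. l \<in> A \<Longrightarrow> b l \<noteq> 0" "\<And>l. l \<in> A \<Longrightarrow> trop (b l) = (s l, real_of_rat (w l))"
    "puiseux_dependency A b"
proof -
  have "\<forall>v. \<exists>d. (\<forall>l\<in>A. w l = v \<longrightarrow> 0 < sign_real (s l) * d l) \<and>
    (\<forall>l\<in>A. v < w l \<longrightarrow> d l = 0) \<and> (\<Sum>l\<in>A. d l *\<^sub>R hom_vec l) = 0"
  proof
    fix v
    show "\<exists>d. (\<forall>l\<in>A. w l = v \<longrightarrow> 0 < sign_real (s l) * d l) \<and>
      (\<forall>l\<in>A. v < w l \<longrightarrow> d l = 0) \<and> (\<Sum>l\<in>A. d l *\<^sub>R hom_vec l) = 0"
      by (rule balanced_dependency[OF assms, of v]) auto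
  qed
  then obtain d where d: "\<And>v l. l \<in> A \<Longrightarrow> w l = v \<Longrightarrow> 0 < sign_real (s l) * d v l"
    "\<And>v l. l \<in> A \<Longrightarrow> v < w l \<Longrightarrow> d v l = 0" "\<And>v. (\<Sum>l\<in>A. d v l *\<^sub>R hom_vec l) = 0"
    by metis
  define b where "b l = (\<Sum>v\<in>w ` A. puiseux_monom v (d v l))" for l
  have pc: "pcoeff (b l) q = (if q \<in> w ` A then d q l else 0)" for l q
    using assms(1) by (simp add: b_def pcoeff_sum pcoeff_puiseux_monom)
  have val: "val (b l) = w l" if "l \<in> A" for l
    using d(1)[OF that refl] d(2)[OF that] that by (intro val_eqI) (auto simp: pc)
  have lead: "0 < sign_real (s l) * pcoeff (b l) (val (b l))" if "l \<in> A" for l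
    using d(1)[OF that refl] that by (simp add: val pc)
  show ?thesis
  proof (rule that[of b])
    show "b l \<noteq> 0" if "l \<in> A" for l using lead[OF that] by (auto simp: zero_puiseux.rep_eq)
    show "trop (b l) = (s l, real_of_rat (w l))" if "l \<in> A" for l
      using fst_trop_eqI[OF lead[OF that]] val[OF that] by (simp add: prod_eq_iff) (simp add: trop_def)
    show "puiseux_dependency A b"
      unfolding puiseux_dependency_iff
    proof
      show "(\<Sum>l\<in>A. pcoeff (b l) q *\<^sub>R hom_vec l) = 0" for q
        using d(3)[of q] by (cases "q \<in> w ` A") (simp_all add: pc)
    qed
  qed
qed

section \<open>Singular points of polynomials\<close>

definition monom_value :: "puiseux ^ 'n \<Rightarrow> nat ^ 'n::finite \<Rightarrow> puiseux" where
  "monom_value P l = (\<Prod>k\<in>UNIV. (P $ k) ^ (l $ k))"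

text \<open>A common index set for several polynomials makes additivity visible even when terms
  cancel in the sum.\<close>

lemma poly_eval_superset:
  assumes "finite B" "Poly_Mapping.keys F \<subseteq> B"
  shows "poly_eval F P = (\<Sum>l\<in>B. Poly_Mapping.lookup F l * monom_value P l)"
  unfolding poly_eval_def monom_value_def using assms
  by (intro sum.mono_neutral_left) (auto simp: in_keys_iff)

lemma poly_eval_0: "poly_eval 0 P = 0"
  by (simp add: poly_eval_def)

lemma poly_eval_add: "poly_eval (F + G) P = poly_eval F P + poly_eval G P"
proof -
  define B where "B = Poly_Mapping.keys F \<union> Poly_Mapping.keys G"
  have "finite B" "Poly_Mapping.keys F \<subseteq> B" "Poly_Mapping.keys G \<subseteq> B" "Poly_Mapping.keys (F + G) \<subseteq> B"
    using Poly_Mapping.keys_add[of F G] by (auto simp: B_def)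
  then show ?thesis
    by (simp add: poly_eval_superset[of B] lookup_add distrib_right sum.distrib)
qed

lemma poly_eval_sum: "poly_eval (\<Sum>i\<in>I. F i) P = (\<Sum>i\<in>I. poly_eval (F i) P)"
  by (induction I rule: infinite_finite_induct) (simp_all add: poly_eval_0 poly_eval_add)

lemma poly_eval_single: "poly_eval (Poly_Mapping.single l c) P = c * monom_value P l"
  by (subst poly_eval_superset[of "{l}"]) (auto simp: lookup_single)

lemma monom_value_diff_axis:
  fixes l :: "nat ^ 'n::finite"
  assumes "l $ k > 0"
  shows "P $ k * monom_value P (l - axis k 1) = monom_value P l"
proof -
  have "monom_value P (l - axis k 1) = (P $ k) ^ (l $ k - 1) * (\<Prod>j\<in>UNIV - {k}. (P $ j) ^ (l $ j))"
    unfolding monom_value_def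
    by (subst prod.remove[of _ k]) (auto simp: axis_def intro!: prod.cong)
  moreover have "monom_value P l = (P $ k) ^ (l $ k) * (\<Prod>j\<in>UNIV - {k}. (P $ j) ^ (l $ j))"
    unfolding monom_value_def by (subst prod.remove[of _ k]) auto
  moreover have "(P $ k) ^ (l $ k) = P $ k * (P $ k) ^ (l $ k - 1)"
    using assms by (cases "l $ k") auto
  ultimately show ?thesis by (simp add: mult_ac)
qed

text \<open>The Euler operator, multiplication by the variable after the derivative, acts diagonally
  on monomials.\<close>

lemma poly_eval_partial_deriv:
  "P $ k * poly_eval (partial_deriv k F) P =
     (\<Sum>l\<in>Poly_Mapping.keys F. of_nat (l $ k) * (Poly_Mapping.lookup F l * monom_value P l))"
proof -
  \<comment> \<open>If \<open>l $ k = 0\<close>, the truncated exponent is wrong but the factor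
    \<open>of_nat (l $ k)\<close> removes the term.\<close>
  have *: "P $ k * (of_nat (l $ k) * Poly_Mapping.lookup F l * monom_value P (l - axis k 1)) =
      of_nat (l $ k) * (Poly_Mapping.lookup F l * monom_value P l)" for l
    by (cases "l $ k > 0") (simp_all add: mult_ac monom_value_diff_axis[symmetric, of l k P])
  show ?thesis
    unfolding partial_deriv_def poly_eval_sum poly_eval_single sum_distrib_left
    by (intro sum.cong refl *)
qed

text \<open>As the coordinates are nonzero, each partial derivative may be replaced by its Euler
  operator; the equations are then those of a dependency among the terms of \<open>F\<close> at
  \<open>P\<close>.\<close>

lemma singular_point_iff:
  fixes P :: "puiseux ^ 'n::finite"
  assumes "\<And>k. P $ k \<noteq> 0"
  shows "singular_point F P \<longleftrightarrow>
    puiseux_dependency (Poly_Mapping.keys F) (\<lambda>l. Poly_Mapping.lookup F l * monom_value P l)"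
proof -
  have "poly_eval (partial_deriv k F) P = 0 \<longleftrightarrow>
     (\<Sum>l\<in>Poly_Mapping.keys F. of_nat (l $ k) * (Poly_Mapping.lookup F l * monom_value P l)) = 0" for k
    using assms by (simp flip: poly_eval_partial_deriv)
  then show ?thesis
    by (simp add: singular_point_def puiseux_dependency_def poly_eval_superset[of "Poly_Mapping.keys F"])
qed

section \<open>Liftable pairs and balanced weights\<close>

lemma monom_value_pos:
  fixes P :: "puiseux ^ 'n::finite"
  shows "(\<And>k. 0 < P $ k) \<Longrightarrow> 0 < monom_value P l"
  by (simp add: monom_value_def prod_pos)

lemma of_rat_val_monom_value:
  fixes P :: "puiseux ^ 'n::finite"
  assumes "\<And>k. P $ k \<noteq> 0"
  shows "real_of_rat (val (monom_value P l)) = real_vec l \<bullet> modulus_vec (trop_vec P)"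
  using assms
  by (simp add: monom_value_def val_prod val_power of_rat_sum of_rat_mult inner_vec_def
      real_vec_def modulus_vec_def trop_vec_def trop_def)

lemma trop_mult_pos:
  assumes "x \<noteq> 0" "0 < y"
  shows "trop (x * y) = (fst (trop x), snd (trop x) + real_of_rat (val y))"
  using assms by (auto simp: trop_def val_mult of_rat_add zero_less_mult_iff)

lemma liftable_imp_balanced:
  fixes A :: "(nat ^ 'n::finite) set" and q :: "tr ^ 'n"
  assumes "(f, q) \<in> liftable_pairs A" "\<And>k. fst (q $ k) = Plus"
  shows "balanced A hom_vec (\<lambda>l. sign_real (fst (f l))) (trop_weight f q)"
proof -
  from assms(1) obtain F and P :: "puiseux ^ 'n" where F: "f = trop_poly F" "q = trop_vec P" "Poly_Mapping.keys F = A"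
    and P: "\<And>k. P $ k \<noteq> 0" and sing: "singular_point F P"
    unfolding liftable_pairs_def by blast
  have Ppos: "0 < P $ k" for k
    using assms(2)[of k] by (auto simp: F(2) trop_vec_def trop_def split: if_splits)
  define b where "b l = Poly_Mapping.lookup F l * monom_value P l" for l
  have fin: "finite A" using F(3) by auto
  have nz: "b l \<noteq> 0" if "l \<in> A" for l
    using that F(3) monom_value_pos[of P l, OF Ppos] by (auto simp: b_def in_keys_iff)
  have trop: "trop (b l) = (fst (f l), trop_weight f q l)" if "l \<in> A" for l
  proof -
    have "trop (b l) = (fst (f l), snd (f l) + real_of_rat (val (monom_value P l)))"
      unfolding b_def using that F
      by (subst trop_mult_pos[OF _ monom_value_pos[OF Ppos]])
        (auto simp: trop_poly_def in_keys_iff)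
    then show ?thesis using of_rat_val_monom_value[OF P] F(2) by (simp add: trop_weight_def)
  qed
  have "puiseux_dependency A b"
    using sing unfolding singular_point_iff[OF P] F(3) b_def .
  then have "balanced A hom_vec (\<lambda>l. sign_real (fst (trop (b l)))) (\<lambda>l. val (b l))"
    using balanced_puiseux_dependency fin nz by blast
  then have "balanced A hom_vec (\<lambda>l. sign_real (fst (trop (b l)))) (trop_weight f q)"
  \<comment> \<open>The weights are the real images of the rational valuations. Both induce the same
    order on \<open>A\<close>, so coarsening serves to change the value type.\<close>
  proof (rule balanced_coarsen[OF fin])
    have "trop_weight f q l = real_of_rat (val (b l))" if "l \<in> A" for l
      using trop[OF that] by (simp add: trop_def)
    then show "val (b l) < val (b j)" if "l \<in> A" "j \<in> A" "trop_weight f q l < trop_weight f q j" for l j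
      using that by (simp add: of_rat_less)
  qed
  then show ?thesis by (rule balanced_sign_cong) (simp add: trop)
qed

text \<open>Take for \<open>P\<close> the powers of \<open>t\<close> with exponents
  \<open>r k\<close>, and divide each term of a dependency by the value of its monomial at
  \<open>P\<close>. This value is positive, so the division keeps the signs and shifts the
  valuations by the pairing of \<open>l\<close> with \<open>r\<close>.\<close>

lemma balanced_imp_liftable:
  fixes A :: "(nat ^ 'n::finite) set" and r :: "'n \<Rightarrow> rat"
  assumes "finite A" "balanced A hom_vec (\<lambda>l. sign_real (s l)) w"
  shows "(\<lambda>l\<in>A. (s l, real_of_rat (w l - (\<Sum>k\<in>UNIV. of_nat (l $ k) * r k))),
      \<chi> k. (Plus, real_of_rat (r k))) \<in> liftable_pairs A"
proof -
  obtain b where nz: "\<And>l. l \<in> A \<Longrightarrow> b l \<noteq> 0"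
    and trop: "\<And>l. l \<in> A \<Longrightarrow> trop (b l) = (s l, real_of_rat (w l))" and dep: "puiseux_dependency A b"
    using balanced_imp_puiseux_dependency[OF assms] by blast
  define P :: "puiseux ^ 'n" where "P = (\<chi> k. puiseux_monom (r k) 1)"
  have Ppos: "0 < P $ k" and Pval: "val (P $ k) = r k" for k
    by (simp_all add: P_def puiseux_monom_1)
  have Pnz: "P $ k \<noteq> 0" for k using Ppos[of k] by simp
  have mpos: "0 < monom_value P l" for l using Ppos by (rule monom_value_pos)
  have mnz: "monom_value P l \<noteq> 0" for l using mpos[of l] by simp
  have mval: "val (inverse (monom_value P l)) = - (\<Sum>k\<in>UNIV. of_nat (l $ k) * r k)" for l
  proof -
    have "val (inverse (monom_value P l)) + val (monom_value P l) = 0"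
      using mpos[of l] by (subst val_mult[symmetric]) (auto simp: val_1)
    moreover have "val (monom_value P l) = (\<Sum>k\<in>UNIV. of_nat (l $ k) * r k)"
      using Pnz by (simp add: monom_value_def val_prod val_power Pval)
    ultimately show ?thesis by simp
  qed
  define F where "F = Abs_poly_mapping (\<lambda>l. if l \<in> A then b l * inverse (monom_value P l) else 0)"
  have lookup: "Poly_Mapping.lookup F = (\<lambda>l. if l \<in> A then b l * inverse (monom_value P l) else 0)"
    unfolding F_def using assms(1) by (intro Abs_poly_mapping_inverse) (auto elim: rev_finite_subset)
  have keys: "Poly_Mapping.keys F = A"
    using nz mnz by (auto simp: in_keys_iff lookup split: if_splits)
  have "trop_poly F = (\<lambda>l\<in>A. (s l, real_of_rat (w l - (\<Sum>k\<in>UNIV. of_nat (l $ k) * r k))))"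
    unfolding trop_poly_def keys
    by (rule restrict_ext)
      (simp add: lookup trop_mult_pos nz mpos trop mval of_rat_diff of_rat_minus)
  moreover have "trop_vec P = (\<chi> k. (Plus, real_of_rat (r k)))"
    using Ppos Pval by (simp add: trop_vec_def trop_def)
  moreover have "singular_point F P"
  proof -
    have "Poly_Mapping.lookup F l * monom_value P l = b l" if "l \<in> A" for l
      using that mnz[of l] by (simp add: lookup)
    then have "puiseux_dependency A (\<lambda>l. Poly_Mapping.lookup F l * monom_value P l)"
      using dep by (simp add: puiseux_dependency_def)
    then show ?thesis using singular_point_iff[OF Pnz] keys by simp
  qed
  ultimately show ?thesis
    unfolding liftable_pairs_def using keys Pnz
    by (intro CollectI exI[of _ F] exI[of _ P]) simp
qed

section \<open>Flags\<close>

lemma inner_hom_vec: "z \<bullet> hom_vec l = fst z + snd z \<bullet> real_vec l"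
  by (simp add: inner_prod_def hom_vec_def)

lemma real_vec_inj: "inj real_vec"
  by (auto simp: inj_def real_vec_def vec_eq_iff)

lemma flag_Suc_newD:
  assumes "l \<in> flag A a p (Suc i)" "l \<notin> flag A a p i"
  shows "l \<in> A" "real_vec l \<notin> affine hull (real_vec ` flag A a p i)"
    and "\<And>j. j \<in> A \<Longrightarrow> real_vec j \<notin> affine hull (real_vec ` flag A a p i) \<Longrightarrow>
          trop_weight a p l \<le> trop_weight a p j"
  using assms by (auto simp: is_arg_min_def not_less)

lemma flag_Suc_newI:
  assumes "l \<in> A" "real_vec l \<notin> affine hull (real_vec ` flag A a p i)"
    and "\<And>j. j \<in> A \<Longrightarrow> real_vec j \<notin> affine hull (real_vec ` flag A a p i) \<Longrightarrow>
          trop_weight a p l \<le> trop_weight a p j"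
  shows "l \<in> flag A a p (Suc i)"
  using assms by (auto simp: is_arg_min_def not_less)

lemma flag_subset: "flag A a p i \<subseteq> A"
  by (induction i) (auto simp: is_arg_min_def)

text \<open>While the span is proper, some exponent lies outside it and one of least weight joins,
  so the cardinalities grow strictly. They are bounded by that of \<open>A\<close>; hence a spanning
  member exists and the \<open>LEAST\<close> in \<open>flag_stop\<close> is attained.\<close>

lemma flag_stop_aff_dim:
  fixes A :: "(nat ^ 'n::finite) set"
  assumes "finite A" "affine hull (real_vec ` A) = UNIV"
  shows "aff_dim (real_vec ` flag A a p (Suc (flag_stop A a p))) = int CARD('n)"
proof -
  have step: "card (flag A a p i) < card (flag A a p (Suc i))"
    if "affine hull (real_vec ` flag A a p i) \<noteq> UNIV" for i
  proof -
    define B where "B = {j \<in> A. real_vec j \<notin> affine hull (real_vec ` flag A a p i)}"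
    have "B \<noteq> {}"
    proof
      assume "B = {}"
      then have "real_vec ` A \<subseteq> affine hull (real_vec ` flag A a p i)" by (auto simp: B_def)
      then have "affine hull (real_vec ` A) \<subseteq> affine hull (real_vec ` flag A a p i)"
        by (simp add: hull_minimal)
      with assms(2) that show False by auto
    qed
    moreover have "finite B" using assms(1) by (simp add: B_def)
    ultimately obtain l where l: "l \<in> B" "\<And>j. j \<in> B \<Longrightarrow> trop_weight a p l \<le> trop_weight a p j"
      using ex_min_if_finite[of "trop_weight a p ` B"] by (force simp: not_less)
    then have "l \<in> flag A a p (Suc i)" by (intro flag_Suc_newI) (auto simp: B_def)
    moreover have "l \<notin> flag A a p i" using l(1) by (auto simp: B_def intro: hull_inc)
    ultimately have "flag A a p i \<subset> flag A a p (Suc i)" by auto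
    moreover have "finite (flag A a p (Suc i))" using flag_subset assms(1) by (rule finite_subset)
    ultimately show ?thesis by (rule psubset_card_mono[rotated])
  qed
  have "\<exists>r. affine hull (real_vec ` flag A a p (Suc r)) = UNIV"
  proof (rule ccontr)
    assume no: "\<nexists>r. affine hull (real_vec ` flag A a p (Suc r)) = UNIV"
    have "i < card (flag A a p (Suc i))" for i
    proof (induction i)
      case 0
      show ?case using step[of 0] by auto
    next
      case (Suc i)
      then show ?case using step[of "Suc i"] no by (metis Suc_leI le_less_trans)
    qed
    then have "card A < card (flag A a p (Suc (card A)))" .
    moreover have "card (flag A a p (Suc (card A))) \<le> card A"
      using flag_subset assms(1) by (intro card_mono)
    ultimately show False by simp
  qed
  then have "\<exists>r. aff_dim (real_vec ` flag A a p (Suc r)) = int CARD('n)"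
    by (metis aff_dim_affine_hull aff_dim_UNIV DIM_cart DIM_real mult.right_neutral)
  then show ?thesis unfolding flag_stop_def by (rule LeastI_ex)
qed

text \<open>Integer affine combinations are real ones, so the affine hull contains the origin and
  the unit vectors. Containing the origin, it is a subspace.\<close>

lemma affine_lattice_imp_affine_hull:
  fixes A :: "(nat ^ 'n::finite) set"
  assumes "finite A" "affine_lattice A = UNIV"
  shows "affine hull (real_vec ` A) = UNIV"
proof -
  have int: "(\<chi> k. real_of_int (m $ k)) \<in> affine hull (real_vec ` A)" for m :: "int ^ 'n"
  proof -
    have "m \<in> affine_lattice A" using assms(2) by simp
    then obtain z where z: "m = (\<chi> k. \<Sum>l\<in>A. z l * int (l $ k))" "(\<Sum>l\<in>A. z l) = 1"
      unfolding affine_lattice_def by blast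
    have inj: "inj_on real_vec A" using real_vec_inj by (rule inj_on_subset) auto
    \<comment> \<open>The description of the hull of a finite set wants coefficients on the points
      themselves, so \<open>z\<close> is transported along the injection
      \<open>real_vec\<close>.\<close>
    define u where "u = (\<lambda>x. real_of_int (z (inv real_vec x)))"
    have "sum u (real_vec ` A) = real_of_int (\<Sum>l\<in>A. z l)"
      by (simp add: sum.reindex[OF inj] u_def inv_f_f[OF real_vec_inj])
    moreover have "(\<Sum>x\<in>real_vec ` A. u x *\<^sub>R x) = (\<Sum>l\<in>A. real_of_int (z l) *\<^sub>R real_vec l)"
      by (simp add: sum.reindex[OF inj] u_def inv_f_f[OF real_vec_inj])
    then have "(\<Sum>x\<in>real_vec ` A. u x *\<^sub>R x) = (\<chi> k. real_of_int (m $ k))"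
      by (simp add: z(1) vec_eq_iff real_vec_def)
    ultimately show ?thesis
      using assms(1) z(2) by (simp add: affine_hull_finite) blast
  qed
  have "(0 :: real ^ 'n) = (\<chi> k. real_of_int ((0 :: int ^ 'n) $ k))"
    by (simp add: vec_eq_iff)
  then have zero: "0 \<in> affine hull (real_vec ` A)" using int by metis
  have "(axis i 1 :: real ^ 'n) = (\<chi> k. real_of_int (axis i (1 :: int) $ k))" for i
    by (simp add: vec_eq_iff axis_def)
  then have "axis i 1 \<in> affine hull (real_vec ` A)" for i using int by metis
  then have "Basis \<subseteq> affine hull (real_vec ` A)" by (auto simp: Basis_vec_def)
  moreover have "subspace (affine hull (real_vec ` A))" using zero by (simp add: subspace_affine)
  ultimately have "span Basis \<subseteq> affine hull (real_vec ` A)" by (rule span_minimal)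
  then show ?thesis by auto
qed

section \<open>Balanced weights and separation along the flag\<close>

text \<open>An affine equation of a separating hyperplane, suitably oriented, is a functional that
  contradicts balancedness at the weight of a new flag member lying off the hyperplane.\<close>

lemma balanced_imp_not_separates:
  fixes A :: "(nat ^ 'n::finite) set"
  assumes bal: "balanced A hom_vec (\<lambda>l. sign_real (fst (a l))) (trop_weight a p)"
    and L: "real_vec ` flag A a p i \<subseteq> L" "\<not> real_vec ` flag A a p (Suc i) \<subseteq> L"
  shows "\<not> separates L (signed_part Plus a (flag A a p (Suc i)))
                      (signed_part Minus a (flag A a p (Suc i)))"
proof
  let ?F = "flag A a p (Suc i)" and ?w = "trop_weight a p"
  assume "separates L (signed_part Plus a ?F) (signed_part Minus a ?F)"
  then obtain y c where y: "L = {x. y \<bullet> x = c}"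
    and sides: "signed_part Plus a ?F \<subseteq> {x. y \<bullet> x \<ge> c} \<and> signed_part Minus a ?F \<subseteq> {x. y \<bullet> x \<le> c} \<or>
       signed_part Plus a ?F \<subseteq> {x. y \<bullet> x \<le> c} \<and> signed_part Minus a ?F \<subseteq> {x. y \<bullet> x \<ge> c}"
    unfolding separates_def by blast
  \<comment> \<open>The factor is 1 or -1 and merges the two possible orientations of the
    separation.\<close>
  obtain \<tau> :: real where \<tau>: "\<tau> \<noteq> 0"
    and nonneg: "\<And>j. j \<in> ?F \<Longrightarrow> 0 \<le> sign_real (fst (a j)) * (\<tau> * (y \<bullet> real_vec j - c))"
  proof -
    have signs: "s = Plus \<or> s = Minus" for s by (cases s) auto
    from sides show ?thesis
    proof
      assume "signed_part Plus a ?F \<subseteq> {x. y \<bullet> x \<ge> c} \<and> signed_part Minus a ?F \<subseteq> {x. y \<bullet> x \<le> c}"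
      then have "0 \<le> sign_real (fst (a j)) * (1 * (y \<bullet> real_vec j - c))" if "j \<in> ?F" for j
        using that signs[of "fst (a j)"] by (force simp: signed_part_def simp del: flag.simps)
      then show ?thesis by (intro that[of 1]) auto
    next
      assume "signed_part Plus a ?F \<subseteq> {x. y \<bullet> x \<le> c} \<and> signed_part Minus a ?F \<subseteq> {x. y \<bullet> x \<ge> c}"
      then have "0 \<le> sign_real (fst (a j)) * (- 1 * (y \<bullet> real_vec j - c))" if "j \<in> ?F" for j
        using that signs[of "fst (a j)"] by (force simp: signed_part_def simp del: flag.simps)
      then show ?thesis by (intro that[of "- 1"]) auto
    qed
  qed
  define z where "z = (- \<tau> * c, \<tau> *\<^sub>R y)"
  have z: "z \<bullet> hom_vec j = \<tau> * (y \<bullet> real_vec j - c)" for j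
    by (simp add: z_def inner_hom_vec algebra_simps)
  have hull: "z \<bullet> hom_vec j = 0" if "real_vec j \<in> affine hull (real_vec ` flag A a p i)" for j
  proof -
    have "affine hull (real_vec ` flag A a p i) \<subseteq> L"
      using L(1) by (intro hull_minimal) (auto simp: y affine_hyperplane)
    then show ?thesis using that by (auto simp: z y)
  qed
  obtain l where l: "l \<in> ?F" "real_vec l \<notin> L" using L(2) by blast
  have new: "l \<notin> flag A a p i" using l L(1) by blast
  \<comment> \<open>Being new, \<open>l\<close> has least weight outside the span of the previous
    flag member. So exponents of smaller weight lie in that span, where \<open>z\<close> vanishes,
    and those of equal weight lie in it or are new themselves.\<close>
  have "z \<bullet> hom_vec l = 0"
  proof (rule balancedD[OF bal, where v = "?w l"])
    show "z \<bullet> hom_vec j = 0" if "j \<in> A" "?w j < ?w l" for j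
      using flag_Suc_newD(3)[OF l(1) new] that hull by (meson not_le)
    show "0 \<le> sign_real (fst (a j)) * (z \<bullet> hom_vec j)" if "j \<in> A" "?w j = ?w l" for j
    proof (cases "real_vec j \<in> affine hull (real_vec ` flag A a p i)")
      case True
      then show ?thesis by (simp add: hull)
    next
      case False
      with that have "j \<in> ?F" using flag_Suc_newD(3)[OF l(1) new] by (intro flag_Suc_newI) auto
      then show ?thesis using nonneg by (simp add: z)
    qed
  qed (use flag_Suc_newD(1)[OF l(1) new] in auto)
  with \<tau> l(2) show False by (simp add: z y)
qed

text \<open>A functional violating balancedness at level \<open>v\<close> defines a hyperplane. The
  exponents that the first flag member not contained in it adds all have weight \<open>v\<close>, so
  their signs are controlled and the hyperplane separates that flag member.\<close>

lemma not_separates_imp_balanced: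
  fixes A :: "(nat ^ 'n::finite) set"
  assumes "finite A" "affine hull (real_vec ` A) = UNIV"
    and nsep: "\<And>i L. i \<le> flag_stop A a p \<Longrightarrow> hyperplane L \<Longrightarrow> real_vec ` flag A a p i \<subseteq> L \<Longrightarrow>
      \<not> real_vec ` flag A a p (Suc i) \<subseteq> L \<Longrightarrow>
      \<not> separates L (signed_part Plus a (flag A a p (Suc i)))
                    (signed_part Minus a (flag A a p (Suc i)))"
  shows "balanced A hom_vec (\<lambda>l. sign_real (fst (a l))) (trop_weight a p)"
proof (rule balancedI, rule ccontr)
  let ?w = "trop_weight a p"
  fix z v l
  assume lt: "\<And>j. j \<in> A \<Longrightarrow> ?w j < v \<Longrightarrow> z \<bullet> hom_vec j = 0"
    and eq: "\<And>j. j \<in> A \<Longrightarrow> ?w j = v \<Longrightarrow> 0 \<le> sign_real (fst (a j)) * (z \<bullet> hom_vec j)"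
    and l: "l \<in> A" "?w l = v" "z \<bullet> hom_vec l \<noteq> 0"
  \<comment> \<open>A constant functional defines no hyperplane; as exponents are nonnegative, it can be
    replaced by a nonconstant one with the same signs on \<open>A\<close>.\<close>
  obtain y c where "y \<noteq> 0" and sgn: "\<And>j. sgn (c + y \<bullet> real_vec j) = sgn (z \<bullet> hom_vec j)"
  proof (cases "snd z = 0")
    case False
    then show ?thesis by (intro that[of "snd z" "fst z"]) (auto simp: inner_hom_vec)
  next
    case True
    define y :: "real ^ 'n" where "y = (\<chi> k. fst z)"
    have "fst z \<noteq> 0" using l(3) True by (simp add: inner_hom_vec)
    then have "y \<noteq> 0" by (simp add: y_def vec_eq_iff)
    moreover have "sgn (fst z + y \<bullet> real_vec j) = sgn (z \<bullet> hom_vec j)" for j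
    proof -
      have "fst z + y \<bullet> real_vec j = fst z * (1 + (\<Sum>k\<in>UNIV. real (j $ k)))"
        by (simp add: y_def inner_vec_def real_vec_def sum_distrib_left distrib_left)
      moreover have "0 < 1 + (\<Sum>k\<in>UNIV. real (j $ k))" by (simp add: add_pos_nonneg sum_nonneg)
      ultimately show ?thesis using True by (simp add: inner_hom_vec sgn_mult)
    qed
    ultimately show ?thesis by (rule that)
  qed
  define L where "L = {x. y \<bullet> x = - c}"
  have L: "real_vec j \<in> L \<longleftrightarrow> z \<bullet> hom_vec j = 0" for j
    using sgn[of j] by (auto simp: L_def sgn_zero_iff[of "z \<bullet> hom_vec j"] algebra_simps
        eq_neg_iff_add_eq_0 simp flip: sgn_zero_iff[of "c + y \<bullet> real_vec j"])
  have hyp: "hyperplane L" using \<open>y \<noteq> 0\<close> by (auto simp: hyperplane_def L_def)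
  \<comment> \<open>The last flag member spans the whole space, so the search for a member leaving
    \<open>L\<close> succeeds no later than \<open>flag_stop\<close>.\<close>
  have "\<not> real_vec ` flag A a p (Suc (flag_stop A a p)) \<subseteq> L"
  proof
    assume "real_vec ` flag A a p (Suc (flag_stop A a p)) \<subseteq> L"
    then have "int CARD('n) \<le> aff_dim L"
      using flag_stop_aff_dim[OF assms(1,2)] aff_dim_subset by metis
    also have "\<dots> = int CARD('n) - 1"
      using \<open>y \<noteq> 0\<close> by (simp add: L_def aff_dim_hyperplane)
    finally show False by simp
  qed
  then obtain i where i: "\<not> real_vec ` flag A a p (Suc i) \<subseteq> L" "i \<le> flag_stop A a p"
      "\<And>j. j < i \<Longrightarrow> real_vec ` flag A a p (Suc j) \<subseteq> L"
    using ex_least_nat_le[of "\<lambda>i. \<not> real_vec ` flag A a p (Suc i) \<subseteq> L" "flag_stop A a p"] by blast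
  \<comment> \<open>For \<open>i = 0\<close> the previous member is empty; otherwise this is the
    minimality of \<open>i\<close>.\<close>
  have prev: "real_vec ` flag A a p i \<subseteq> L" using i(3) by (cases i) auto
  then have hull: "affine hull (real_vec ` flag A a p i) \<subseteq> L"
    by (intro hull_minimal) (auto simp: L_def affine_hyperplane)
  obtain m where m: "m \<in> flag A a p (Suc i)" "real_vec m \<notin> L" using i(1) by blast
  have new: "m \<notin> flag A a p i" using m prev by blast
  note mD = flag_Suc_newD[OF m(1) new]
  \<comment> \<open>Since \<open>l\<close> lies off \<open>L\<close> it lies outside the previous
    span, so \<open>m\<close> weighs at most \<open>v\<close>; it weighs no less because the
    functional vanishes below \<open>v\<close>.\<close>
  have "?w m \<le> ?w l" using mD(3)[OF l(1)] l(3) hull L by blast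
  moreover have "\<not> ?w m < v" using lt[OF mD(1)] m(2) L by blast
  ultimately have wm: "?w m = v" using l(2) by simp
  have nonneg: "0 \<le> sign_real (fst (a j)) * (z \<bullet> hom_vec j)" if j: "j \<in> flag A a p (Suc i)" for j
  proof (cases "j \<in> flag A a p i")
    case True
    then show ?thesis using prev L[of j] by auto
  next
    case False
    note jD = flag_Suc_newD[OF j False]
    have "?w j = v" using mD(3)[OF jD(1,2)] jD(3)[OF mD(1,2)] wm by simp
    then show ?thesis using eq jD(1) by blast
  qed
  have sgn_le: "0 \<le> z \<bullet> hom_vec j \<longleftrightarrow> - c \<le> y \<bullet> real_vec j"
    "z \<bullet> hom_vec j \<le> 0 \<longleftrightarrow> y \<bullet> real_vec j \<le> - c" for j
    using sgn[of j] by (auto simp: sgn_if split: if_splits)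
  have "separates L (signed_part Plus a (flag A a p (Suc i)))
                    (signed_part Minus a (flag A a p (Suc i)))"
    unfolding separates_def
  proof
    have "real_vec m \<in> signed_part Plus a (flag A a p (Suc i)) \<union> signed_part Minus a (flag A a p (Suc i))"
      using m(1) by (cases "fst (a m)") (auto simp: signed_part_def simp del: flag.simps)
    then show "\<not> signed_part Plus a (flag A a p (Suc i)) \<union> signed_part Minus a (flag A a p (Suc i)) \<subseteq> L"
      using m(2) by blast
    have "signed_part Plus a (flag A a p (Suc i)) \<subseteq> {x. - c \<le> y \<bullet> x}"
      using nonneg by (force simp: signed_part_def sgn_le[symmetric] simp del: flag.simps)
    moreover have "signed_part Minus a (flag A a p (Suc i)) \<subseteq> {x. y \<bullet> x \<le> - c}"
      using nonneg by (force simp: signed_part_def sgn_le[symmetric] simp del: flag.simps)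
    ultimately show "\<exists>v c. v \<noteq> 0 \<and> L = {x. v \<bullet> x = c} \<and>
        (signed_part Plus a (flag A a p (Suc i)) \<subseteq> {x. v \<bullet> x \<ge> c} \<and>
         signed_part Minus a (flag A a p (Suc i)) \<subseteq> {x. v \<bullet> x \<le> c} \<or>
         signed_part Plus a (flag A a p (Suc i)) \<subseteq> {x. v \<bullet> x \<le> c} \<and>
         signed_part Minus a (flag A a p (Suc i)) \<subseteq> {x. v \<bullet> x \<ge> c})"
      using \<open>y \<noteq> 0\<close> L_def by blast
  qed
  with nsep[OF i(2) hyp prev i(1)] show False by simp
qed

section \<open>The closure of the liftable pairs\<close>

lemma floor_scaled_tendsto:
  fixes x :: real
  shows "(\<lambda>N. real_of_int \<lfloor>real (Suc N) * x\<rfloor> / real (Suc N)) \<longlonglongrightarrow> x"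
proof (rule tendsto_sandwich)
  show "(\<lambda>N. x - inverse (real (Suc N))) \<longlonglongrightarrow> x"
    using tendsto_diff[OF tendsto_const LIMSEQ_inverse_real_of_nat, of x] by simp
  show "\<forall>\<^sub>F N in sequentially. x - inverse (real (Suc N)) \<le> real_of_int \<lfloor>real (Suc N) * x\<rfloor> / real (Suc N)"
  proof (rule always_eventually, rule allI)
    fix N
    have "real (Suc N) * x - 1 \<le> real_of_int \<lfloor>real (Suc N) * x\<rfloor>" by linarith
    then have "(real (Suc N) * x - 1) / real (Suc N) \<le> real_of_int \<lfloor>real (Suc N) * x\<rfloor> / real (Suc N)"
      by (rule divide_right_mono) simp
    then show "x - inverse (real (Suc N)) \<le> real_of_int \<lfloor>real (Suc N) * x\<rfloor> / real (Suc N)"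
      by (simp add: diff_divide_distrib inverse_eq_divide)
  qed
  show "\<forall>\<^sub>F N in sequentially. real_of_int \<lfloor>real (Suc N) * x\<rfloor> / real (Suc N) \<le> x"
  proof (rule always_eventually, rule allI)
    fix N
    have "real_of_int \<lfloor>real (Suc N) * x\<rfloor> / real (Suc N) \<le> (real (Suc N) * x) / real (Suc N)"
      by (rule divide_right_mono) (simp_all del: of_nat_Suc)
    then show "real_of_int \<lfloor>real (Suc N) * x\<rfloor> / real (Suc N) \<le> x" by simp
  qed
qed auto

text \<open>Signs are locally constant and strict inequalities between weights persist nearby. A
  liftable pair close to the given one therefore has the same signs and an order of weights that at
  most breaks ties, and balancedness passes to the coarser order.\<close>

lemma trop_singular_imp_balanced:
  fixes A :: "(nat ^ 'n::finite) set" and p :: "tr ^ 'n"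
  assumes "finite A" "trop_singular A a p" and p: "\<And>k. fst (p $ k) = Plus"
  shows "balanced A hom_vec (\<lambda>l. sign_real (fst (a l))) (trop_weight a p)"
proof -
  define X :: "((nat ^ 'n \<Rightarrow> tr) \<times> (tr ^ 'n)) topology"
    where "X = prod_topology (product_topology (\<lambda>_. euclidean) A) euclidean"
  define x where "x = (restrict a A, p)"
  \<comment> \<open>Along the neighbourhood filter every coordinate converges to its value at
    \<open>x\<close>, so limit theorems yield properties valid on a whole neighbourhood.\<close>
  define N where "N = nhdsin X x"
  have cl: "x \<in> X closure_of liftable_pairs A"
    using assms(2) by (simp add: trop_singular_def X_def x_def)
  then have top: "x \<in> topspace X" by (simp add: in_closure_of)
  have "limitin X (\<lambda>y. y) x N"
    unfolding limitin_def N_def eventually_nhdsin using top by blast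
  then have "limitin (product_topology (\<lambda>_. euclidean) A) fst (restrict a A) N"
    and lim2: "(snd \<longlongrightarrow> p) N"
    by (simp_all add: X_def limitin_pairwise o_def x_def)
  then have lim1: "((\<lambda>y. fst y l) \<longlongrightarrow> a l) N" if "l \<in> A" for l
    using that by (simp add: limitin_componentwise)
  have lim3: "((\<lambda>y. snd y $ k) \<longlongrightarrow> p $ k) N" for k using lim2 by (rule tendsto_vec_nth)
  have sign: "\<forall>\<^sub>F y in N. fst (f y) = fst t" if "(f \<longlongrightarrow> t) N" for f :: "_ \<Rightarrow> tr" and t
  proof -
    have "((\<lambda>y. fst (f y)) \<longlongrightarrow> fst t) N" using that by (rule tendsto_fst)
    then show ?thesis using topological_tendstoD[of _ "fst t" N "{fst t}"] by (simp add: open_sign_def)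
  qed
  have weight: "((\<lambda>y. trop_weight (fst y) (snd y) l) \<longlongrightarrow> trop_weight a p l) N" if "l \<in> A" for l
    unfolding trop_weight_def modulus_vec_def
    by (intro tendsto_intros tendsto_vec_lambda lim1[OF that] lim3)
  have order: "\<forall>\<^sub>F y in N. trop_weight a p l < trop_weight a p j \<longrightarrow>
      trop_weight (fst y) (snd y) l < trop_weight (fst y) (snd y) j" if "l \<in> A" "j \<in> A" for l j
  proof (cases "trop_weight a p l < trop_weight a p j")
    case True
    have "((\<lambda>y. trop_weight (fst y) (snd y) j - trop_weight (fst y) (snd y) l) \<longlongrightarrow>
        trop_weight a p j - trop_weight a p l) N"
      by (intro tendsto_diff weight that)
    then have "\<forall>\<^sub>F y in N. 0 < trop_weight (fst y) (snd y) j - trop_weight (fst y) (snd y) l"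
      by (rule order_tendstoD) (use True in simp)
    then show ?thesis by eventually_elim simp
  qed simp
  define good where "good y \<longleftrightarrow>
     (\<forall>k. fst (snd y $ k) = Plus) \<and> (\<forall>l\<in>A. fst (fst y l) = fst (a l)) \<and>
     (\<forall>l\<in>A. \<forall>j\<in>A. trop_weight a p l < trop_weight a p j \<longrightarrow>
        trop_weight (fst y) (snd y) l < trop_weight (fst y) (snd y) j)" for y :: "_ \<times> (tr ^ 'n)"
  have "eventually good N"
    unfolding good_def using sign[OF lim3] sign[OF lim1] order
    by (intro eventually_conj eventually_ball_finite eventually_all_finite ballI assms(1))
      (simp_all add: p)
  then obtain T where T: "openin X T" "x \<in> T" "\<forall>y\<in>T. good y"
    unfolding N_def eventually_nhdsin using top by blast
  from cl T(1,2) obtain y where "y \<in> liftable_pairs A" "y \<in> T"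
    unfolding in_closure_of by blast
  then obtain f q where fq: "(f, q) \<in> liftable_pairs A" "good (f, q)"
    using T(3) by (cases y) blast
  note good = fq(2)[unfolded good_def fst_conv snd_conv]
  have "balanced A hom_vec (\<lambda>l. sign_real (fst (f l))) (trop_weight f q)"
    using good by (intro liftable_imp_balanced[OF fq(1)]) auto
  then have "balanced A hom_vec (\<lambda>l. sign_real (fst (f l))) (trop_weight a p)"
    by (rule balanced_coarsen[OF assms(1)]) (use good in auto)
  then show ?thesis by (rule balanced_sign_cong) (use good in simp)
qed

text \<open>Rational data of the same balanced type converge to the given pair, and balanced
  rational data are liftable.\<close>

lemma balanced_imp_trop_singular:
  fixes A :: "(nat ^ 'n::finite) set" and p :: "tr ^ 'n"
  assumes "finite A" "balanced A hom_vec (\<lambda>l. sign_real (fst (a l))) (trop_weight a p)"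
    and p: "\<And>k. fst (p $ k) = Plus"
  shows "trop_singular A a p"
proof -
  define g where "g N x = (of_int \<lfloor>real (Suc N) * x\<rfloor> / of_nat (Suc N) :: rat)" for N x
  have g: "(\<lambda>N. real_of_rat (g N x)) \<longlonglongrightarrow> x" for x
    using floor_scaled_tendsto[of x] by (simp only: g_def of_rat_divide of_rat_of_int_eq of_rat_of_nat_eq)
  \<comment> \<open>Rounding preserves the weak order of the weights, which is all that balancedness needs.\<close>
  have g_mono: "x < y" if "g N x < g N y" for N and x y :: real
  proof (rule ccontr)
    assume "\<not> x < y"
    then have "\<lfloor>real (Suc N) * y\<rfloor> \<le> \<lfloor>real (Suc N) * x\<rfloor>"
      by (intro floor_mono mult_left_mono) auto
    then have "g N y \<le> g N x" unfolding g_def by (intro divide_right_mono) auto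
    with that show False by simp
  qed
  \<comment> \<open>The weights are rounded, not the coefficients; the coefficients are recovered by
    subtracting the pairing with the rounded point. Thus ties among weights survive, which
    independent rounding of the coefficients could destroy.\<close>
  define f where "f N = (\<lambda>l\<in>A. (fst (a l), real_of_rat (g N (trop_weight a p l) -
    (\<Sum>k\<in>UNIV. of_nat (l $ k) * g N (snd (p $ k))))))" for N
  define q :: "nat \<Rightarrow> tr ^ 'n" where "q N = (\<chi> k. (Plus, real_of_rat (g N (snd (p $ k)))))" for N
  have "(f N, q N) \<in> liftable_pairs A" for N
    unfolding f_def q_def
    by (intro balanced_imp_liftable[OF assms(1)] balanced_coarsen[OF assms(1,2)]) (rule g_mono)
  moreover have "limitin (prod_topology (product_topology (\<lambda>_. euclidean) A) euclidean)
     (\<lambda>N. (f N, q N)) (restrict a A, p) sequentially"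
  proof -
    have "(\<lambda>N. f N l) \<longlonglongrightarrow> a l" if "l \<in> A" for l
    proof -
      have "(\<lambda>N. (fst (a l), real_of_rat (g N (trop_weight a p l)) -
          (\<Sum>k\<in>UNIV. real (l $ k) * real_of_rat (g N (snd (p $ k)))))) \<longlonglongrightarrow>
          (fst (a l), trop_weight a p l - (\<Sum>k\<in>UNIV. real (l $ k) * snd (p $ k)))"
        by (intro tendsto_Pair tendsto_const tendsto_diff tendsto_sum tendsto_mult g)
      moreover have "trop_weight a p l - (\<Sum>k\<in>UNIV. real (l $ k) * snd (p $ k)) = snd (a l)"
        by (simp add: trop_weight_def inner_vec_def real_vec_def modulus_vec_def)
      ultimately show ?thesis
        using that by (simp add: f_def of_rat_diff of_rat_sum of_rat_mult)
    qed
    moreover have "q \<longlonglongrightarrow> p"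
    proof (rule vec_tendstoI)
      fix k
      have "(\<lambda>N. (Plus, real_of_rat (g N (snd (p $ k))))) \<longlonglongrightarrow> (Plus, snd (p $ k))"
        by (intro tendsto_Pair tendsto_const g)
      moreover have "p $ k = (Plus, snd (p $ k))" using p[of k] by (simp add: prod_eq_iff)
      ultimately show "(\<lambda>N. q N $ k) \<longlonglongrightarrow> p $ k" by (simp add: q_def)
    qed
    ultimately show ?thesis
      by (simp add: limitin_pairwise o_def limitin_componentwise f_def PiE_def)
  qed
  ultimately show ?thesis
    unfolding trop_singular_def in_closure_of limitin_def eventually_sequentially
    by (metis order_refl)
qed

theorem theorem4p7:
  fixes A :: "(nat ^ 'n::finite) set"
    and a :: "nat ^ 'n \<Rightarrow> tr"
    and p :: "tr ^ 'n"
  assumes "finite A"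
    and "affine_lattice A = UNIV"
    and "\<And>k. fst (p $ k) = Plus"
  shows "trop_singular A a p \<longleftrightarrow>
    (\<forall>i \<le> flag_stop A a p. \<forall>L. hyperplane L
        \<and> real_vec ` flag A a p i \<subseteq> L
        \<and> \<not> real_vec ` flag A a p (Suc i) \<subseteq> L
      \<longrightarrow> \<not> separates L (signed_part Plus a (flag A a p (Suc i)))
                        (signed_part Minus a (flag A a p (Suc i))))"
proof -
  have "trop_singular A a p \<longleftrightarrow>
      balanced A hom_vec (\<lambda>l. sign_real (fst (a l))) (trop_weight a p)"
    using trop_singular_imp_balanced[OF assms(1) _ assms(3)]
      balanced_imp_trop_singular[OF assms(1) _ assms(3)] by blast
  also have "\<dots> \<longleftrightarrow> (\<forall>i \<le> flag_stop A a p. \<forall>L. hyperplane L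
        \<and> real_vec ` flag A a p i \<subseteq> L
        \<and> \<not> real_vec ` flag A a p (Suc i) \<subseteq> L
      \<longrightarrow> \<not> separates L (signed_part Plus a (flag A a p (Suc i)))
                        (signed_part Minus a (flag A a p (Suc i))))"
    (is "_ \<longleftrightarrow> ?nsep")
  proof
    show ?nsep if "balanced A hom_vec (\<lambda>l. sign_real (fst (a l))) (trop_weight a p)"
      using balanced_imp_not_separates[OF that] by blast
    show "balanced A hom_vec (\<lambda>l. sign_real (fst (a l))) (trop_weight a p)" if ?nsep
      by (rule not_separates_imp_balanced[OF assms(1) affine_lattice_imp_affine_hull[OF assms(1,2)]])
        (use that in blast)
  qed
  finally show ?thesis .
qed

end
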